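(* Let $\mathbf G$ be a non-trivial integral residuated lattice, let $I_1\subseteq I_0$ be sets with $I_1$ non-empty, let $\lambda\colon I_1\to I_0$ be injective, and let $K^\lambda_{I_0,I_1}(\mathbf G)$ be the corresponding kite. The following statements are equivalent: (1) $\mathbf G$ is subdirectly irreducible and for all $i,j\in I_0$ there is an integer $m\ge0$ such that $\lambda^m(i)=j$ or $\lambda^m(j)=i$. (2) $K^\lambda_{I_0,I_1}(\mathbf G)$ is subdirectly irreducible.
   Context: $\mathbb N=\{0,1,2,\dots\}$. A residuated lattice is an algebra $\mathbf G=(G;\wedge,\vee,\cdot,\backslash,/,e)$ such that $(G;\wedge,\vee)$ is a lattice, $(G;\cdot,e)$ is a monoid, and $x\cdot y\le z$ iff $y\le x\backslash z$ iff $x\le z/y$ for all $x,y,z\in G$. It is integral if $x\le e$ for all $x\in G$; it is non-trivial if $G\ne\{e\}$. A non-trivial residuated lattice is subdirectly irreducible if it has a least non-identity congruence. The kite $K^\lambda_{I_0,I_1}(\mathbf G)$ is the following integral residuated lattice. For $n\ge1$ put $I_{n+1}=\{i\in I_n: \lambda(i)\in I_n\}$. Then $\lambda^{m-n}$ is a well-defined injective map $I_m\to I_n$ for $n\le m$; $\lambda^{-m}$ denotes the inverse of $\lambda^m$ on its image. The universe is the disjoint union $\biguplus_{n\in\mathbb N}G^{I_n}$ (different $n$ always give disjoint parts; if $I_n=\emptyset$, $G^{I_n}$ is a singleton), with elements written $\langle x_i: i\in I_n\rangle$. Order: $\langle x_i: i\in I_n\rangle\le\langle y_i: i\in I_m\rangle$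 iff $m<n$, or $m=n$ and $x_i\le y_i$ for all $i\in I_n$. Unit: $1\in G^{I_0}$ with all coordinates $e$. Product: $\langle x_i: i\in I_m\rangle\cdot\langle y_i: i\in I_n\rangle=\langle x_{\lambda^n(i)}y_i: i\in I_{m+n}\rangle$. Right division: $\langle y_i: i\in I_n\rangle/\!/\langle x_i: i\in I_m\rangle$ is $1$ if $m>n$; if $m\le n$ it is the element of $G^{I_{n-m}}$ with $i$-th coordinate $y_{\lambda^{-m}(i)}/x_{\lambda^{-m}(i)}$ if $i\in\lambda^m(I_n)$ and $e$ otherwise. Left division: $\langle y_i: i\in I_n\rangle\backslash\!\backslash\langle x_i: i\in I_m\rangle$ is $1$ if $n>m$; if $n\le m$ it is the element of $G^{I_{m-n}}$ with $i$-th coordinate $y_{\lambda^{m-n}(i)}\backslash x_i$ if $i\in I_m$ and $e$ otherwise. In (1), $\lambda$ is a partial map on $I_0$ and $\lambda^m(i)=j$ means that $\lambda^m(i)$ is defined and equals $j$ ($\lambda^0$ is the identity of $I_0$). *)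

theory Defs
  imports "HOL-Algebra.Group"
begin

section \<open>Residuated lattices\<close>

text \<open>\<open>ldiv L x z\<close> is $x \backslash z$ and \<open>rdiv L z y\<close> is $z / y$.\<close>

record 'a residuated_lattice = "'a monoid" +
  rmeet :: "'a \<Rightarrow> 'a \<Rightarrow> 'a"  (infixl \<open>\<curlywedge>\<index>\<close> 70)
  rjoin :: "'a \<Rightarrow> 'a \<Rightarrow> 'a"  (infixl \<open>\<curlyvee>\<index>\<close> 65)
  ldiv :: "'a \<Rightarrow> 'a \<Rightarrow> 'a"
  rdiv :: "'a \<Rightarrow> 'a \<Rightarrow> 'a"

definition rle :: "('a, 'm) residuated_lattice_scheme \<Rightarrow> 'a \<Rightarrow> 'a \<Rightarrow> bool"  (infix \<open>\<preceq>\<index>\<close> 50)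
  where "x \<preceq>\<^bsub>L\<^esub> y \<longleftrightarrow> x \<curlywedge>\<^bsub>L\<^esub> y = x"

locale residuated_lattice = monoid L for L (structure) +
  assumes meet_closed: "\<lbrakk>x \<in> carrier L; y \<in> carrier L\<rbrakk> \<Longrightarrow> x \<curlywedge> y \<in> carrier L"
    and join_closed: "\<lbrakk>x \<in> carrier L; y \<in> carrier L\<rbrakk> \<Longrightarrow> x \<curlyvee> y \<in> carrier L"
    and ldiv_closed: "\<lbrakk>x \<in> carrier L; y \<in> carrier L\<rbrakk> \<Longrightarrow> ldiv L x y \<in> carrier L"
    and rdiv_closed: "\<lbrakk>x \<in> carrier L; y \<in> carrier L\<rbrakk> \<Longrightarrow> rdiv L x y \<in> carrier L"
    and meet_comm: "\<lbrakk>x \<in> carrier L; y \<in> carrier L\<rbrakk> \<Longrightarrow> x \<curlywedge> y = y \<curlywedge> x"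
    and join_comm: "\<lbrakk>x \<in> carrier L; y \<in> carrier L\<rbrakk> \<Longrightarrow> x \<curlyvee> y = y \<curlyvee> x"
    and meet_assoc: "\<lbrakk>x \<in> carrier L; y \<in> carrier L; z \<in> carrier L\<rbrakk>
          \<Longrightarrow> (x \<curlywedge> y) \<curlywedge> z = x \<curlywedge> (y \<curlywedge> z)"
    and join_assoc: "\<lbrakk>x \<in> carrier L; y \<in> carrier L; z \<in> carrier L\<rbrakk>
          \<Longrightarrow> (x \<curlyvee> y) \<curlyvee> z = x \<curlyvee> (y \<curlyvee> z)"
    and meet_absorb: "\<lbrakk>x \<in> carrier L; y \<in> carrier L\<rbrakk> \<Longrightarrow> x \<curlywedge> (x \<curlyvee> y) = x"
    and join_absorb: "\<lbrakk>x \<in> carrier L; y \<in> carrier L\<rbrakk> \<Longrightarrow> x \<curlyvee> (x \<curlywedge> y) = x"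
    and ldiv_resid: "\<lbrakk>x \<in> carrier L; y \<in> carrier L; z \<in> carrier L\<rbrakk>
          \<Longrightarrow> x \<otimes> y \<preceq> z \<longleftrightarrow> y \<preceq> ldiv L x z"
    and rdiv_resid: "\<lbrakk>x \<in> carrier L; y \<in> carrier L; z \<in> carrier L\<rbrakk>
          \<Longrightarrow> x \<otimes> y \<preceq> z \<longleftrightarrow> x \<preceq> rdiv L z y"

locale integral_residuated_lattice = residuated_lattice +
  assumes integral: "x \<in> carrier L \<Longrightarrow> x \<preceq> \<one>"

definition nontrivial :: "('a, 'm) residuated_lattice_scheme \<Rightarrow> bool"
  where "nontrivial L \<longleftrightarrow> carrier L \<noteq> {\<one>\<^bsub>L\<^esub>}"

definition rl_congruence :: "('a, 'm) residuated_lattice_scheme \<Rightarrow> ('a \<times> 'a) set \<Rightarrow> bool"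
  where "rl_congruence L \<theta> \<longleftrightarrow> equiv (carrier L) \<theta> \<and>
    (\<forall>f \<in> {mult L, rmeet L, rjoin L, ldiv L, rdiv L}.
       \<forall>x x' y y'. (x, x') \<in> \<theta> \<longrightarrow> (y, y') \<in> \<theta> \<longrightarrow> (f x y, f x' y') \<in> \<theta>)"

definition subdirectly_irreducible :: "('a, 'm) residuated_lattice_scheme \<Rightarrow> bool"
  where "subdirectly_irreducible L \<longleftrightarrow> residuated_lattice L \<and> nontrivial L \<and>
    (\<exists>\<mu>. rl_congruence L \<mu> \<and> \<mu> \<noteq> Id_on (carrier L) \<and>
         (\<forall>\<theta>. rl_congruence L \<theta> \<and> \<theta> \<noteq> Id_on (carrier L) \<longrightarrow> \<mu> \<subseteq> \<theta>))"

context residuated_lattice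
begin

lemma meet_idem: "x \<in> carrier L \<Longrightarrow> x \<curlywedge> x = x"
  by (metis meet_absorb join_absorb meet_closed)

lemma le_refl: "x \<in> carrier L \<Longrightarrow> x \<preceq> x"
  by (simp add: rle_def meet_idem)

lemma le_antisym: "\<lbrakk>x \<in> carrier L; y \<in> carrier L; x \<preceq> y; y \<preceq> x\<rbrakk> \<Longrightarrow> x = y"
  by (metis rle_def meet_comm)

lemma le_trans:
  "\<lbrakk>x \<in> carrier L; y \<in> carrier L; z \<in> carrier L; x \<preceq> y; y \<preceq> z\<rbrakk> \<Longrightarrow> x \<preceq> z"
  by (metis rle_def meet_assoc)

lemma le_iff_join: "\<lbrakk>x \<in> carrier L; y \<in> carrier L\<rbrakk> \<Longrightarrow> x \<preceq> y \<longleftrightarrow> x \<curlyvee> y = y"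
  by (metis rle_def meet_comm join_comm meet_absorb join_absorb)

lemma meet_le1: "\<lbrakk>x \<in> carrier L; y \<in> carrier L\<rbrakk> \<Longrightarrow> x \<curlywedge> y \<preceq> x"
  by (metis rle_def meet_comm meet_assoc meet_idem meet_closed)

lemma meet_le2: "\<lbrakk>x \<in> carrier L; y \<in> carrier L\<rbrakk> \<Longrightarrow> x \<curlywedge> y \<preceq> y"
  by (metis meet_comm meet_le1)

lemma le_meetI:
  "\<lbrakk>x \<in> carrier L; y \<in> carrier L; z \<in> carrier L; z \<preceq> x; z \<preceq> y\<rbrakk> \<Longrightarrow> z \<preceq> x \<curlywedge> y"
  by (metis rle_def meet_assoc)

lemma join_ge1: "\<lbrakk>x \<in> carrier L; y \<in> carrier L\<rbrakk> \<Longrightarrow> x \<preceq> x \<curlyvee> y"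
  by (simp add: rle_def meet_absorb)

lemma join_ge2: "\<lbrakk>x \<in> carrier L; y \<in> carrier L\<rbrakk> \<Longrightarrow> y \<preceq> x \<curlyvee> y"
  by (metis join_comm join_ge1)

lemma join_leI:
  "\<lbrakk>x \<in> carrier L; y \<in> carrier L; z \<in> carrier L; x \<preceq> z; y \<preceq> z\<rbrakk> \<Longrightarrow> x \<curlyvee> y \<preceq> z"
  by (metis le_iff_join join_assoc join_closed)

end


section \<open>Kites\<close>

text \<open>Throughout, \<open>lam\<close> is a total HOL function of which only the restriction to \<open>I1\<close> matters.\<close>

text \<open>\<open>kite_index I0 I1 lam n\<close> is $I_n$, the domain of the $n$-th iterate of the partial map.\<close>

fun kite_index :: "'i set \<Rightarrow> 'i set \<Rightarrow> ('i \<Rightarrow> 'i) \<Rightarrow> nat \<Rightarrow> 'i set" where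
  "kite_index I0 I1 lam 0 = I0"
| "kite_index I0 I1 lam (Suc 0) = I1"
| "kite_index I0 I1 lam (Suc (Suc n)) =
     {i \<in> kite_index I0 I1 lam (Suc n). lam i \<in> kite_index I0 I1 lam (Suc n)}"

text \<open>The level \<open>n\<close> is kept as a tag, so that distinct levels are disjoint even when they have
  the same (possibly empty) index set.\<close>

type_synonym ('i, 'a) kite_elem = "nat \<times> ('i \<Rightarrow> 'a)"

definition kite_carrier ::
    "'i set \<Rightarrow> 'i set \<Rightarrow> ('i \<Rightarrow> 'i) \<Rightarrow> ('a, 'm) residuated_lattice_scheme \<Rightarrow> ('i, 'a) kite_elem set"
  where "kite_carrier I0 I1 lam G =
    (SIGMA n:UNIV. kite_index I0 I1 lam n \<rightarrow>\<^sub>E carrier G)"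

definition kite_one ::
    "'i set \<Rightarrow> ('a, 'm) residuated_lattice_scheme \<Rightarrow> ('i, 'a) kite_elem"
  where "kite_one I0 G = (0, \<lambda>i\<in>I0. \<one>\<^bsub>G\<^esub>)"

fun kite_le :: "'i set \<Rightarrow> 'i set \<Rightarrow> ('i \<Rightarrow> 'i) \<Rightarrow> ('a, 'm) residuated_lattice_scheme
    \<Rightarrow> ('i, 'a) kite_elem \<Rightarrow> ('i, 'a) kite_elem \<Rightarrow> bool"
  where "kite_le I0 I1 lam G (n, x) (m, y) \<longleftrightarrow>
    m < n \<or> (m = n \<and> (\<forall>i \<in> kite_index I0 I1 lam n. x i \<preceq>\<^bsub>G\<^esub> y i))"

definition kite_order :: "'i set \<Rightarrow> 'i set \<Rightarrow> ('i \<Rightarrow> 'i) \<Rightarrow> ('a, 'm) residuated_lattice_scheme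
    \<Rightarrow> ('i, 'a) kite_elem gorder"
  where "kite_order I0 I1 lam G =
    \<lparr>carrier = kite_carrier I0 I1 lam G, eq = (=), le = kite_le I0 I1 lam G\<rparr>"

fun kite_mult :: "'i set \<Rightarrow> 'i set \<Rightarrow> ('i \<Rightarrow> 'i) \<Rightarrow> ('a, 'm) residuated_lattice_scheme
    \<Rightarrow> ('i, 'a) kite_elem \<Rightarrow> ('i, 'a) kite_elem \<Rightarrow> ('i, 'a) kite_elem"
  where "kite_mult I0 I1 lam G (m, x) (n, y) =
    (m + n, \<lambda>i \<in> kite_index I0 I1 lam (m + n). x ((lam ^^ n) i) \<otimes>\<^bsub>G\<^esub> y i)"

text \<open>The inverse of the \<open>m\<close>-th iterate is taken on its domain $I_m$, where it is injective.\<close>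

fun kite_rdiv :: "'i set \<Rightarrow> 'i set \<Rightarrow> ('i \<Rightarrow> 'i) \<Rightarrow> ('a, 'm) residuated_lattice_scheme
    \<Rightarrow> ('i, 'a) kite_elem \<Rightarrow> ('i, 'a) kite_elem \<Rightarrow> ('i, 'a) kite_elem"
  where "kite_rdiv I0 I1 lam G (n, y) (m, x) =
    (if m > n then kite_one I0 G
     else (n - m, \<lambda>i \<in> kite_index I0 I1 lam (n - m).
       if i \<in> (lam ^^ m) ` kite_index I0 I1 lam n
       then rdiv G (y (inv_into (kite_index I0 I1 lam m) (lam ^^ m) i))
                   (x (inv_into (kite_index I0 I1 lam m) (lam ^^ m) i))
       else \<one>\<^bsub>G\<^esub>))"

fun kite_ldiv :: "'i set \<Rightarrow> 'i set \<Rightarrow> ('i \<Rightarrow> 'i) \<Rightarrow> ('a, 'm) residuated_lattice_scheme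
    \<Rightarrow> ('i, 'a) kite_elem \<Rightarrow> ('i, 'a) kite_elem \<Rightarrow> ('i, 'a) kite_elem"
  where "kite_ldiv I0 I1 lam G (n, y) (m, x) =
    (if n > m then kite_one I0 G
     else (m - n, \<lambda>i \<in> kite_index I0 I1 lam (m - n).
       if i \<in> kite_index I0 I1 lam m
       then ldiv G (y ((lam ^^ (m - n)) i)) (x i)
       else \<one>\<^bsub>G\<^esub>))"

definition kite :: "'i set \<Rightarrow> 'i set \<Rightarrow> ('i \<Rightarrow> 'i) \<Rightarrow> ('a, 'm) residuated_lattice_scheme
    \<Rightarrow> ('i, 'a) kite_elem residuated_lattice"
  where "kite I0 I1 lam G =
    \<lparr>carrier = kite_carrier I0 I1 lam G,
     mult = kite_mult I0 I1 lam G,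
     one = kite_one I0 G,
     rmeet = meet (kite_order I0 I1 lam G),
     rjoin = join (kite_order I0 I1 lam G),
     ldiv = kite_ldiv I0 I1 lam G,
     rdiv = kite_rdiv I0 I1 lam G\<rparr>"

text \<open>\<open>piter I1 lam m i j\<close>: the \<open>m\<close>-th iterate of the partial map \<open>lam\<close> with domain \<open>I1\<close> is
  defined at \<open>i\<close> and has value \<open>j\<close>.\<close>

definition piter :: "'i set \<Rightarrow> ('i \<Rightarrow> 'i) \<Rightarrow> nat \<Rightarrow> 'i \<Rightarrow> 'i \<Rightarrow> bool"
  where "piter I1 lam m i j \<longleftrightarrow> (i, j) \<in> {(k, lam k) |k. k \<in> I1} ^^ m"


subsection \<open>The kite is an integral residuated lattice\<close>

locale kite_data = integral_residuated_lattice G for G (structure) +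
  fixes I0 I1 :: "'i set" and lam :: "'i \<Rightarrow> 'i"
  assumes I1_sub: "I1 \<subseteq> I0" and lam_funcset: "lam \<in> I1 \<rightarrow> I0" and lam_inj: "inj_on lam I1"
begin

abbreviation "J \<equiv> kite_index I0 I1 lam"
abbreviation "K \<equiv> kite I0 I1 lam G"
abbreviation "Ko \<equiv> kite_order I0 I1 lam G"

lemma index_Suc: "J (Suc n) = {i \<in> I1. lam i \<in> J n}"
proof (induction n)
  case 0
  then show ?case using lam_funcset by auto
next
  case (Suc n)
  have sub: "J (Suc (Suc n)) \<subseteq> J (Suc n)" by auto
  show ?case
  proof (intro equalityI subsetI)
    fix i assume "i \<in> J (Suc (Suc n))"
    then show "i \<in> {i \<in> I1. lam i \<in> J (Suc n)}" using Suc by auto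
  next
    fix i assume i: "i \<in> {i \<in> I1. lam i \<in> J (Suc n)}"
    have "J (Suc n) \<subseteq> J n" using I1_sub by (cases n) auto
    then have "i \<in> J (Suc n)" using i Suc by auto
    then show "i \<in> J (Suc (Suc n))" using i by auto
  qed
qed

lemma index_add: "i \<in> J (m + n) \<longleftrightarrow> i \<in> J n \<and> (lam ^^ n) i \<in> J m"
proof (induction n arbitrary: i)
  case 0
  have "i \<in> J m \<Longrightarrow> i \<in> I0" using I1_sub by (cases m) (auto simp: index_Suc)
  then show ?case by auto
next
  case (Suc n)
  show ?case unfolding add_Suc_right index_Suc funpow_Suc_right using Suc by auto
qed

lemma index_antimono: "n \<le> m \<Longrightarrow> J m \<subseteq> J n"
  using index_add[of _ "m - n" n] by auto

lemma index_iter: "n \<le> m \<Longrightarrow> i \<in> J m \<Longrightarrow> (lam ^^ (m - n)) i \<in> J n"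
  using index_add[of i n "m - n"] by auto

lemma iter_inj: "inj_on (lam ^^ n) (J n)"
proof (induction n)
  case 0
  then show ?case by simp
next
  case (Suc n)
  show ?case
  proof (rule inj_onI)
    fix i j
    assume ij: "i \<in> J (Suc n)" "j \<in> J (Suc n)" and eq: "(lam ^^ Suc n) i = (lam ^^ Suc n) j"
    have "lam i = lam j"
      using Suc ij eq by (simp only: funpow_Suc_right o_apply index_Suc inj_on_def) blast
    then show "i = j" using ij lam_inj by (auto simp only: index_Suc inj_on_def)
  qed
qed

lemma piter_iff: "i \<in> I0 \<Longrightarrow> piter I1 lam m i j \<longleftrightarrow> i \<in> J m \<and> (lam ^^ m) i = j"
proof (induction m arbitrary: i)
  case 0
  then show ?case by (auto simp: piter_def)
next
  case (Suc m)
  have "piter I1 lam (Suc m) i j \<longleftrightarrow> i \<in> I1 \<and> piter I1 lam m (lam i) j"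
  proof -
    have "(i, j) \<in> R ^^ Suc m \<longleftrightarrow> (\<exists>k. (i, k) \<in> R \<and> (k, j) \<in> R ^^ m)" for R :: "'i rel"
      by (meson relpow_Suc_E2 relpow_Suc_I2)
    then show ?thesis unfolding piter_def by auto
  qed
  also have "\<dots> \<longleftrightarrow> i \<in> J (Suc m) \<and> (lam ^^ Suc m) i = j"
    unfolding index_Suc funpow_Suc_right using Suc.IH lam_funcset by auto
  finally show ?case .
qed

lemma kite_carrier_iff: "(n, x) \<in> carrier K \<longleftrightarrow> x \<in> J n \<rightarrow>\<^sub>E carrier G"
  by (simp add: kite_def kite_carrier_def)

lemma kite_order_lattice: "partial_order Ko"
proof (unfold_locales, goal_cases)
  case (5 x y)
  obtain n u m v where [simp]: "x = (n, u)" "y = (m, v)" by (cases x; cases y)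
  from 5 have nm: "m = n" by (auto simp: kite_order_def)
  have uv: "u \<in> J n \<rightarrow>\<^sub>E carrier G" "v \<in> J n \<rightarrow>\<^sub>E carrier G"
    using 5 nm by (auto simp: kite_order_def kite_carrier_def)
  have "u = v"
  proof (rule PiE_ext[OF uv])
    fix i assume "i \<in> J n"
    then show "u i = v i" using 5 nm uv
      by (intro le_antisym) (auto simp: kite_order_def)
  qed
  then show ?case using nm by (simp add: kite_order_def)
next
  case (6 x y z)
  obtain n u m v k w where [simp]: "x = (n, u)" "y = (m, v)" "z = (k, w)"
    by (cases x; cases y; cases z)
  show ?case
  proof (cases "k < n")
    case True
    then show ?thesis by (simp add: kite_order_def)
  next
    case False
    then have nk: "m = n" "k = n" using 6 by (auto simp: kite_order_def)
    have "u i \<preceq> w i" if "i \<in> J n" for i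
      using 6 nk that
      by (intro le_trans[of "u i" "v i" "w i"]) (auto simp: kite_order_def kite_carrier_def)
    then show ?thesis using nk by (simp add: kite_order_def)
  qed
qed (auto simp: kite_order_def kite_carrier_def intro!: le_refl dest: PiE_mem)

lemma Ko_simps [simp]: "carrier Ko = kite_carrier I0 I1 lam G" "le Ko = kite_le I0 I1 lam G"
  by (simp_all add: kite_order_def)

text \<open>Explicit form of the lattice operations.\<close>

lemma kite_meet_greatest:
  assumes "(n, x) \<in> carrier K" "(m, y) \<in> carrier K"
  shows "greatest Ko (if m < n then (n, x) else if n < m then (m, y)
           else (n, \<lambda>i\<in>J n. x i \<curlywedge> y i)) (Lower Ko {(n, x), (m, y)})"
proof (rule greatest_LowerI)
  fix z assume "z \<in> {(n, x), (m, y)}"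
  then show "(if m < n then (n, x) else if n < m then (m, y)
           else (n, \<lambda>i\<in>J n. x i \<curlywedge> y i)) \<sqsubseteq>\<^bsub>Ko\<^esub> z"
    using assms by (auto simp: kite_carrier_iff intro!: le_refl meet_le1 meet_le2 dest: PiE_mem)
next
  fix z assume z: "z \<in> Lower Ko {(n, x), (m, y)}"
  obtain k w where [simp]: "z = (k, w)" by (cases z)
  have "(k, w) \<in> carrier K" "kite_le I0 I1 lam G (k, w) (n, x)"
    "kite_le I0 I1 lam G (k, w) (m, y)"
    using z assms by (auto simp: Lower_def kite_def)
  then show "z \<sqsubseteq>\<^bsub>Ko\<^esub> (if m < n then (n, x) else if n < m then (m, y)
           else (n, \<lambda>i\<in>J n. x i \<curlywedge> y i))"
    using assms by (auto simp: kite_carrier_iff intro!: le_meetI dest: PiE_mem)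
next
  show "{(n, x), (m, y)} \<subseteq> carrier Ko"
    using assms by (auto simp: kite_def)
  show "(if m < n then (n, x) else if n < m then (m, y)
           else (n, \<lambda>i\<in>J n. x i \<curlywedge> y i)) \<in> carrier Ko"
    using assms by (auto simp: kite_def kite_carrier_def intro!: meet_closed dest: PiE_mem)
qed

lemma kite_join_least:
  assumes "(n, x) \<in> carrier K" "(m, y) \<in> carrier K"
  shows "least Ko (if m < n then (m, y) else if n < m then (n, x)
           else (n, \<lambda>i\<in>J n. x i \<curlyvee> y i)) (Upper Ko {(n, x), (m, y)})"
proof (rule least_UpperI)
  fix z assume "z \<in> {(n, x), (m, y)}"
  then show "z \<sqsubseteq>\<^bsub>Ko\<^esub> (if m < n then (m, y) else if n < m then (n, x)
           else (n, \<lambda>i\<in>J n. x i \<curlyvee> y i))"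
    using assms by (auto simp: kite_carrier_iff intro!: le_refl join_ge1 join_ge2 dest: PiE_mem)
next
  fix z assume z: "z \<in> Upper Ko {(n, x), (m, y)}"
  obtain k w where [simp]: "z = (k, w)" by (cases z)
  have "(k, w) \<in> carrier K" "kite_le I0 I1 lam G (n, x) (k, w)"
    "kite_le I0 I1 lam G (m, y) (k, w)"
    using z assms by (auto simp: Upper_def kite_def)
  then show "(if m < n then (m, y) else if n < m then (n, x)
           else (n, \<lambda>i\<in>J n. x i \<curlyvee> y i)) \<sqsubseteq>\<^bsub>Ko\<^esub> z"
    using assms by (auto simp: kite_carrier_iff intro!: join_leI dest: PiE_mem)
next
  show "{(n, x), (m, y)} \<subseteq> carrier Ko"
    using assms by (auto simp: kite_def)
  show "(if m < n then (m, y) else if n < m then (n, x)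
           else (n, \<lambda>i\<in>J n. x i \<curlyvee> y i)) \<in> carrier Ko"
    using assms by (auto simp: kite_def kite_carrier_def intro!: join_closed dest: PiE_mem)
qed

sublocale ko: partial_order Ko by (rule kite_order_lattice)

lemma kite_meet:
  assumes "(n, x) \<in> carrier K" "(m, y) \<in> carrier K"
  shows "rmeet K (n, x) (m, y) = (if m < n then (n, x) else if n < m then (m, y)
           else (n, \<lambda>i\<in>J n. x i \<curlywedge> y i))"
proof -
  have "rmeet K (n, x) (m, y) = (SOME z. greatest Ko z (Lower Ko {(n, x), (m, y)}))"
    by (simp add: kite_def meet_def Lattice.inf_def)
  also have "\<dots> = (if m < n then (n, x) else if n < m then (m, y)
           else (n, \<lambda>i\<in>J n. x i \<curlywedge> y i))"
    by (rule some_equality, rule kite_meet_greatest[OF assms])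
      (erule ko.greatest_unique, rule kite_meet_greatest[OF assms])
  finally show ?thesis .
qed

lemma kite_join:
  assumes "(n, x) \<in> carrier K" "(m, y) \<in> carrier K"
  shows "rjoin K (n, x) (m, y) = (if m < n then (m, y) else if n < m then (n, x)
           else (n, \<lambda>i\<in>J n. x i \<curlyvee> y i))"
proof -
  have "rjoin K (n, x) (m, y) = (SOME z. least Ko z (Upper Ko {(n, x), (m, y)}))"
    by (simp add: kite_def join_def Lattice.sup_def)
  also have "\<dots> = (if m < n then (m, y) else if n < m then (n, x)
           else (n, \<lambda>i\<in>J n. x i \<curlyvee> y i))"
    by (rule some_equality, rule kite_join_least[OF assms])
      (erule ko.least_unique, rule kite_join_least[OF assms])
  finally show ?thesis .
qed

lemma kite_lattice_ops: "rmeet K = meet Ko" "rjoin K = join Ko" "carrier K = carrier Ko"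
  by (simp_all add: kite_def)

sublocale ko: lattice Ko
proof (unfold_locales, goal_cases)
  case (1 x y)
  obtain n u m v where "x = (n, u)" "y = (m, v)" by (cases x; cases y)
  then show ?case using kite_join_least[of n u m v] 1 unfolding kite_lattice_ops by blast
next
  case (2 x y)
  obtain n u m v where "x = (n, u)" "y = (m, v)" by (cases x; cases y)
  then show ?case using kite_meet_greatest[of n u m v] 2 unfolding kite_lattice_ops by blast
qed

lemma kite_le_iff:
  assumes "(n, x) \<in> carrier K" "(m, y) \<in> carrier K"
  shows "(n, x) \<preceq>\<^bsub>K\<^esub> (m, y) \<longleftrightarrow> kite_le I0 I1 lam G (n, x) (m, y)"
proof (cases "m = n")
  case True
  have x: "x \<in> J n \<rightarrow>\<^sub>E carrier G" using assms by (simp add: kite_carrier_iff)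
  have "(\<lambda>i\<in>J n. x i \<curlywedge> y i) = x \<longleftrightarrow> (\<forall>i\<in>J n. x i \<curlywedge> y i = x i)"
  proof
    assume eq: "(\<lambda>i\<in>J n. x i \<curlywedge> y i) = x"
    show "\<forall>i\<in>J n. x i \<curlywedge> y i = x i"
    proof
      fix i assume "i \<in> J n"
      then show "x i \<curlywedge> y i = x i" using fun_cong[OF eq, of i] by simp
    qed
  next
    assume "\<forall>i\<in>J n. x i \<curlywedge> y i = x i"
    then have "(\<lambda>i\<in>J n. x i \<curlywedge> y i) = (\<lambda>i\<in>J n. x i)" by (auto intro: restrict_ext)
    then show "(\<lambda>i\<in>J n. x i \<curlywedge> y i) = x" using x by (simp add: PiE_restrict)
  qed
  then show ?thesis
    unfolding rle_def[of K] kite_meet[OF assms] using True by (simp add: rle_def)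
next
  case False
  then show ?thesis
    unfolding rle_def[of K] kite_meet[OF assms] by auto
qed

lemma kite_ops [simp]:
  "mult K = kite_mult I0 I1 lam G" "one K = kite_one I0 G"
  "ldiv K = kite_ldiv I0 I1 lam G" "rdiv K = kite_rdiv I0 I1 lam G"
  by (simp_all add: kite_def)

lemma inv_iter: "m \<le> n \<Longrightarrow> i \<in> J n \<Longrightarrow> inv_into (J m) (lam ^^ m) ((lam ^^ m) i) = i"
  using iter_inj[of m] index_antimono[of m n] by (auto intro: inv_into_f_f)

lemma kite_one_closed: "kite_one I0 G \<in> carrier K"
  by (simp add: kite_one_def kite_carrier_iff)

lemma kite_mult_closed:
  assumes "(m, x) \<in> carrier K" "(n, y) \<in> carrier K"
  shows "(m, x) \<otimes>\<^bsub>K\<^esub> (n, y) \<in> carrier K"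
  using assms by (auto simp: kite_carrier_iff index_add dest!: PiE_mem intro!: m_closed)

lemma kite_ldiv_closed:
  assumes "(m, x) \<in> carrier K" "(n, y) \<in> carrier K"
  shows "ldiv K (m, x) (n, y) \<in> carrier K"
proof (cases "m \<le> n")
  case True
  have "ldiv G (x ((lam ^^ (n - m)) i)) (y i) \<in> carrier G" if "i \<in> J n" for i
    using assms index_iter[OF True that] that
    by (intro ldiv_closed) (auto simp: kite_carrier_iff dest: PiE_mem)
  then show ?thesis using True by (auto simp: kite_carrier_iff)
next
  case False
  then show ?thesis using kite_one_closed by simp
qed

lemma kite_rdiv_closed:
  assumes "(n, y) \<in> carrier K" "(m, x) \<in> carrier K"
  shows "rdiv K (n, y) (m, x) \<in> carrier K"
proof (cases "m \<le> n")
  case True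
  have "rdiv G (y i) (x i) \<in> carrier G" if "i \<in> J n" for i
    using assms index_antimono[OF True] that
    by (intro rdiv_closed) (auto simp: kite_carrier_iff dest: PiE_mem)
  then show ?thesis using True by (auto simp: kite_carrier_iff inv_iter)
next
  case False
  then show ?thesis using kite_one_closed by simp
qed

lemma kite_ldiv_resid:
  assumes x: "(m, x) \<in> carrier K" and y: "(n, y) \<in> carrier K" and z: "(k, z) \<in> carrier K"
  shows "(m, x) \<otimes>\<^bsub>K\<^esub> (n, y) \<preceq>\<^bsub>K\<^esub> (k, z) \<longleftrightarrow> (n, y) \<preceq>\<^bsub>K\<^esub> ldiv K (m, x) (k, z)"
proof -
  have mc: "y i \<in> carrier G" if "i \<in> J n" for i
    using y that by (auto simp: kite_carrier_iff dest: PiE_mem)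
  have L: "(m, x) \<otimes>\<^bsub>K\<^esub> (n, y) \<preceq>\<^bsub>K\<^esub> (k, z) \<longleftrightarrow> k < m + n \<or> (k = m + n \<and>
      (\<forall>i\<in>J (m + n). x ((lam ^^ n) i) \<otimes> y i \<preceq> z i))"
    using kite_le_iff[OF _ z] kite_mult_closed[OF x y] by simp
  show ?thesis
  proof (cases "m \<le> k")
    case False
    then have "ldiv K (m, x) (k, z) = kite_one I0 G" by simp
    moreover have "(n, y) \<preceq>\<^bsub>K\<^esub> kite_one I0 G"
      using kite_le_iff[OF y] kite_one_closed mc by (auto simp: kite_one_def intro!: integral)
    ultimately show ?thesis using L False by simp
  next
    case True
    have R: "(n, y) \<preceq>\<^bsub>K\<^esub> ldiv K (m, x) (k, z) \<longleftrightarrow> k - m < n \<or> (k - m = n \<and>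
        (\<forall>i\<in>J n. y i \<preceq> (if i \<in> J k then ldiv G (x ((lam ^^ (k - m)) i)) (z i) else \<one>)))"
    proof -
      define w where "w = (\<lambda>i\<in>J (k - m).
        if i \<in> J k then ldiv G (x ((lam ^^ (k - m)) i)) (z i) else \<one>)"
      have eq: "ldiv K (m, x) (k, z) = (k - m, w)" using True by (simp add: w_def)
      have "(k - m, w) \<in> carrier K" using kite_ldiv_closed[OF x z] unfolding eq .
      from kite_le_iff[OF y this] show ?thesis unfolding eq kite_le.simps
        by (auto simp: w_def simp del: kite_ops)
    qed
    have "(\<forall>i\<in>J (m + n). x ((lam ^^ n) i) \<otimes> y i \<preceq> z i) \<longleftrightarrow>
        (\<forall>i\<in>J n. y i \<preceq> (if i \<in> J k then ldiv G (x ((lam ^^ (k - m)) i)) (z i) else \<one>))"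
      if k: "k = m + n"
    proof -
      have "x ((lam ^^ n) i) \<otimes> y i \<preceq> z i \<longleftrightarrow> y i \<preceq> ldiv G (x ((lam ^^ n) i)) (z i)"
        if "i \<in> J (m + n)" for i
        using that x y z k
        by (intro ldiv_resid) (auto simp: index_add kite_carrier_iff dest: PiE_mem)
      then show ?thesis using k integral mc by (auto simp: index_add)
    qed
    moreover have "k - m < n \<longleftrightarrow> k < m + n" "k - m = n \<longleftrightarrow> k = m + n" using True by auto
    ultimately show ?thesis unfolding L R by blast
  qed
qed

lemma kite_rdiv_resid:
  assumes x: "(m, x) \<in> carrier K" and y: "(n, y) \<in> carrier K" and z: "(k, z) \<in> carrier K"
  shows "(m, x) \<otimes>\<^bsub>K\<^esub> (n, y) \<preceq>\<^bsub>K\<^esub> (k, z) \<longleftrightarrow> (m, x) \<preceq>\<^bsub>K\<^esub> rdiv K (k, z) (n, y)"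
proof -
  have mc: "x i \<in> carrier G" if "i \<in> J m" for i
    using x that by (auto simp: kite_carrier_iff dest: PiE_mem)
  have L: "(m, x) \<otimes>\<^bsub>K\<^esub> (n, y) \<preceq>\<^bsub>K\<^esub> (k, z) \<longleftrightarrow> k < m + n \<or> (k = m + n \<and>
      (\<forall>i\<in>J (m + n). x ((lam ^^ n) i) \<otimes> y i \<preceq> z i))"
    using kite_le_iff[OF _ z] kite_mult_closed[OF x y] by simp
  show ?thesis
  proof (cases "n \<le> k")
    case False
    then have "rdiv K (k, z) (n, y) = kite_one I0 G" by simp
    moreover have "(m, x) \<preceq>\<^bsub>K\<^esub> kite_one I0 G"
      using kite_le_iff[OF x] kite_one_closed mc by (auto simp: kite_one_def intro!: integral)
    ultimately show ?thesis using L False by simp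
  next
    case True
    let ?g = "inv_into (J n) (lam ^^ n)"
    have R: "(m, x) \<preceq>\<^bsub>K\<^esub> rdiv K (k, z) (n, y) \<longleftrightarrow> k - n < m \<or> (k - n = m \<and>
        (\<forall>i\<in>J m. x i \<preceq> (if i \<in> (lam ^^ n) ` J k then rdiv G (z (?g i)) (y (?g i)) else \<one>)))"
    proof -
      define w where "w = (\<lambda>i\<in>J (k - n).
        if i \<in> (lam ^^ n) ` J k then rdiv G (z (?g i)) (y (?g i)) else \<one>)"
      have eq: "rdiv K (k, z) (n, y) = (k - n, w)" using True by (simp add: w_def)
      have "(k - n, w) \<in> carrier K" using kite_rdiv_closed[OF z y] unfolding eq .
      from kite_le_iff[OF x this] show ?thesis unfolding eq kite_le.simps
        by (auto simp: w_def simp del: kite_ops)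
    qed
    have "(\<forall>i\<in>J (m + n). x ((lam ^^ n) i) \<otimes> y i \<preceq> z i) \<longleftrightarrow>
        (\<forall>i\<in>J m. x i \<preceq> (if i \<in> (lam ^^ n) ` J k then rdiv G (z (?g i)) (y (?g i)) else \<one>))"
      if k: "k = m + n"
    proof -
      have *: "x ((lam ^^ n) i) \<otimes> y i \<preceq> z i \<longleftrightarrow> x ((lam ^^ n) i) \<preceq> rdiv G (z i) (y i)"
        if "i \<in> J (m + n)" for i
        using that x y z k
        by (intro rdiv_resid) (auto simp: index_add kite_carrier_iff dest: PiE_mem)
      have inv: "?g ((lam ^^ n) i) = i" if "i \<in> J k" for i
        using inv_iter[OF True that] .
      have mem: "(lam ^^ n) i \<in> J m" if "i \<in> J k" for i
        using that k by (simp add: index_add)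
      show ?thesis
      proof
        assume "\<forall>i\<in>J (m + n). x ((lam ^^ n) i) \<otimes> y i \<preceq> z i"
        then show "\<forall>i\<in>J m. x i \<preceq>
            (if i \<in> (lam ^^ n) ` J k then rdiv G (z (?g i)) (y (?g i)) else \<one>)"
          using * inv k integral mc by auto
      next
        assume A: "\<forall>i\<in>J m. x i \<preceq>
            (if i \<in> (lam ^^ n) ` J k then rdiv G (z (?g i)) (y (?g i)) else \<one>)"
        show "\<forall>i\<in>J (m + n). x ((lam ^^ n) i) \<otimes> y i \<preceq> z i"
        proof
          fix i assume i: "i \<in> J (m + n)"
          then have ik: "i \<in> J k" using k by simp
          have "x ((lam ^^ n) i) \<preceq> rdiv G (z i) (y i)"
            using bspec[OF A mem[OF ik]] ik inv[OF ik] by simp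
          then show "x ((lam ^^ n) i) \<otimes> y i \<preceq> z i" using *[OF i] by simp
        qed
      qed
    qed
    moreover have "k - n < m \<longleftrightarrow> k < m + n" "k - n = m \<longleftrightarrow> k = m + n" using True by auto
    ultimately show ?thesis unfolding L R by blast
  qed
qed

lemma kite_mult_assoc:
  assumes "(m, x) \<in> carrier K" "(n, y) \<in> carrier K" "(k, z) \<in> carrier K"
  shows "((m, x) \<otimes>\<^bsub>K\<^esub> (n, y)) \<otimes>\<^bsub>K\<^esub> (k, z) = (m, x) \<otimes>\<^bsub>K\<^esub> ((n, y) \<otimes>\<^bsub>K\<^esub> (k, z))"
proof -
  have "(x ((lam ^^ n) ((lam ^^ k) i)) \<otimes> y ((lam ^^ k) i)) \<otimes> z i =
      x ((lam ^^ n) ((lam ^^ k) i)) \<otimes> (y ((lam ^^ k) i) \<otimes> z i)"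
    if "i \<in> J (m + n + k)" for i
    using assms that
    by (intro m_assoc) (auto simp: kite_carrier_iff index_add dest: PiE_mem)
  moreover have "i \<in> J (n + k)" "(lam ^^ k) i \<in> J (m + n)" if "i \<in> J (m + n + k)" for i
    using that by (auto simp: index_add)
  ultimately show ?thesis
    by (auto simp: fun_eq_iff restrict_def add.assoc funpow_add)
qed

lemma kite_one_mult:
  assumes "(m, x) \<in> carrier K"
  shows "\<one>\<^bsub>K\<^esub> \<otimes>\<^bsub>K\<^esub> (m, x) = (m, x)" "(m, x) \<otimes>\<^bsub>K\<^esub> \<one>\<^bsub>K\<^esub> = (m, x)"
proof -
  have x: "x \<in> J m \<rightarrow>\<^sub>E carrier G" using assms by (simp add: kite_carrier_iff)
  have r: "restrict x (J m) = x" using x by (rule PiE_restrict)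
  have "(\<lambda>i\<in>J m. (if (lam ^^ m) i \<in> I0 then \<one> else undefined) \<otimes> x i) = restrict x (J m)"
    by (rule restrict_ext) (use index_add[of _ 0 m] x in \<open>auto intro!: l_one dest: PiE_mem\<close>)
  then show "\<one>\<^bsub>K\<^esub> \<otimes>\<^bsub>K\<^esub> (m, x) = (m, x)"
    by (simp add: kite_one_def restrict_def[of _ I0] r)
  have "(\<lambda>i\<in>J m. x i \<otimes> (if i \<in> I0 then \<one> else undefined)) = restrict x (J m)"
    by (rule restrict_ext) (use index_add[of _ m 0] x in \<open>auto intro!: r_one dest: PiE_mem\<close>)
  then show "(m, x) \<otimes>\<^bsub>K\<^esub> \<one>\<^bsub>K\<^esub> = (m, x)"
    by (simp add: kite_one_def restrict_def[of _ I0] r)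
qed

theorem kite_integral_residuated_lattice: "integral_residuated_lattice K"
proof unfold_locales
  fix x y z assume x: "x \<in> carrier K" and y: "y \<in> carrier K" and z: "z \<in> carrier K"
  show "x \<otimes>\<^bsub>K\<^esub> y \<otimes>\<^bsub>K\<^esub> z = x \<otimes>\<^bsub>K\<^esub> (y \<otimes>\<^bsub>K\<^esub> z)"
    using kite_mult_assoc[of "fst x" "snd x" "fst y" "snd y" "fst z" "snd z"] x y z by (simp del: kite_ops)
  show "x \<curlywedge>\<^bsub>K\<^esub> y \<curlywedge>\<^bsub>K\<^esub> z = x \<curlywedge>\<^bsub>K\<^esub> (y \<curlywedge>\<^bsub>K\<^esub> z)"
    using ko.meet_assoc[of x y z] x y z unfolding kite_lattice_ops by blast
  show "x \<curlyvee>\<^bsub>K\<^esub> y \<curlyvee>\<^bsub>K\<^esub> z = x \<curlyvee>\<^bsub>K\<^esub> (y \<curlyvee>\<^bsub>K\<^esub> z)"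
    using ko.join_assoc[of x y z] x y z unfolding kite_lattice_ops by blast
  show "(x \<otimes>\<^bsub>K\<^esub> y \<preceq>\<^bsub>K\<^esub> z) = (y \<preceq>\<^bsub>K\<^esub> ldiv K x z)"
    using kite_ldiv_resid[of "fst x" "snd x" "fst y" "snd y" "fst z" "snd z"] x y z by (simp del: kite_ops)
  show "(x \<otimes>\<^bsub>K\<^esub> y \<preceq>\<^bsub>K\<^esub> z) = (x \<preceq>\<^bsub>K\<^esub> rdiv K z y)"
    using kite_rdiv_resid[of "fst x" "snd x" "fst y" "snd y" "fst z" "snd z"] x y z by (simp del: kite_ops)
next
  fix x y assume x: "x \<in> carrier K" and y: "y \<in> carrier K"
  show "x \<otimes>\<^bsub>K\<^esub> y \<in> carrier K"
    using kite_mult_closed[of "fst x" "snd x" "fst y" "snd y"] x y by (simp del: kite_ops)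
  show "ldiv K x y \<in> carrier K"
    using kite_ldiv_closed[of "fst x" "snd x" "fst y" "snd y"] x y by (simp del: kite_ops)
  show "rdiv K x y \<in> carrier K"
    using kite_rdiv_closed[of "fst x" "snd x" "fst y" "snd y"] x y by (simp del: kite_ops)
  have xy: "x \<in> carrier Ko" "y \<in> carrier Ko"
    using x y unfolding kite_lattice_ops .
  show "x \<curlywedge>\<^bsub>K\<^esub> y \<in> carrier K" "x \<curlyvee>\<^bsub>K\<^esub> y \<in> carrier K"
    using ko.meet_closed[OF xy] ko.join_closed[OF xy] unfolding kite_lattice_ops .
  show "x \<curlywedge>\<^bsub>K\<^esub> y = y \<curlywedge>\<^bsub>K\<^esub> x" "x \<curlyvee>\<^bsub>K\<^esub> y = y \<curlyvee>\<^bsub>K\<^esub> x"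
    unfolding kite_lattice_ops meet_def join_def by (simp_all add: insert_commute)
  have "x \<sqinter>\<^bsub>Ko\<^esub> (x \<squnion>\<^bsub>Ko\<^esub> y) = x"
  proof (rule ko.le_antisym)
    show "x \<sqinter>\<^bsub>Ko\<^esub> (x \<squnion>\<^bsub>Ko\<^esub> y) \<sqsubseteq>\<^bsub>Ko\<^esub> x"
      using ko.meet_left ko.join_closed xy by blast
    show "x \<sqsubseteq>\<^bsub>Ko\<^esub> x \<sqinter>\<^bsub>Ko\<^esub> (x \<squnion>\<^bsub>Ko\<^esub> y)"
      by (rule ko.meet_le[OF ko.le_refl[OF xy(1)] ko.join_left[OF xy] xy(1)
            ko.join_closed[OF xy] xy(1)])
  qed (use ko.meet_closed ko.join_closed xy in blast)+
  then show "x \<curlywedge>\<^bsub>K\<^esub> (x \<curlyvee>\<^bsub>K\<^esub> y) = x" unfolding kite_lattice_ops .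
  have "x \<squnion>\<^bsub>Ko\<^esub> (x \<sqinter>\<^bsub>Ko\<^esub> y) = x"
  proof (rule ko.le_antisym)
    show "x \<sqsubseteq>\<^bsub>Ko\<^esub> x \<squnion>\<^bsub>Ko\<^esub> (x \<sqinter>\<^bsub>Ko\<^esub> y)"
      using ko.join_left ko.meet_closed xy by blast
    show "x \<squnion>\<^bsub>Ko\<^esub> (x \<sqinter>\<^bsub>Ko\<^esub> y) \<sqsubseteq>\<^bsub>Ko\<^esub> x"
      by (rule ko.join_le[OF ko.le_refl[OF xy(1)] ko.meet_left[OF xy] xy(1)
            ko.meet_closed[OF xy] xy(1)])
  qed (use ko.meet_closed ko.join_closed xy in blast)+
  then show "x \<curlyvee>\<^bsub>K\<^esub> (x \<curlywedge>\<^bsub>K\<^esub> y) = x" unfolding kite_lattice_ops .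
next
  show "\<one>\<^bsub>K\<^esub> \<in> carrier K" using kite_one_closed by simp
next
  fix x assume x: "x \<in> carrier K"
  show "\<one>\<^bsub>K\<^esub> \<otimes>\<^bsub>K\<^esub> x = x" "x \<otimes>\<^bsub>K\<^esub> \<one>\<^bsub>K\<^esub> = x"
    using kite_one_mult[of "fst x" "snd x"] x by (simp_all del: kite_ops)
  obtain n u where nu: "x = (n, u)" by (cases x)
  have "kite_le I0 I1 lam G (n, u) (kite_one I0 G)"
    using x nu by (auto simp: kite_one_def kite_carrier_iff intro!: integral dest: PiE_mem)
  then show "x \<preceq>\<^bsub>K\<^esub> \<one>\<^bsub>K\<^esub>"
    using kite_le_iff[of n u 0 "\<lambda>i\<in>I0. \<one>"] x kite_one_closed nu by (simp add: kite_one_def)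
qed

end

end

theory Submission
  imports Defs
begin

text \<open>
  In an integral residuated lattice a congruence is determined by the class of the unit, and
  these classes are exactly the normal filters.  Hence subdirect irreducibility says that a
  single non-unit element lies in every nontrivial normal filter
  (\<open>subdirectly_irreducible_iff\<close>), and both implications become statements about normal filters
  of the kite.

  Level \<open>0\<close> of the kite is the power of \<open>G\<close> with exponent \<open>I0\<close>, and conjugating one of its
  elements by the constant unit of level \<open>n\<close> moves coordinates along \<open>lam ^^ n\<close>, forwards or
  backwards depending on the side.

  If \<open>G\<close> has a non-unit \<open>c\<close> in all its nontrivial normal filters and any two indices are linked
  by an iterate of \<open>lam\<close>, let \<open>spike i g\<close> be the level \<open>0\<close> element with value \<open>g\<close> at \<open>i\<close> and the
  unit elsewhere.  A nontrivial normal filter of the kite is an up-set, so it contains a spike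
  with a non-unit value at some \<open>i\<close> (\<open>nontrivial_filter_spike\<close>).  The values of its spikes at \<open>i\<close>
  form a normal filter of \<open>G\<close> (\<open>spike_filter\<close>), so they include \<open>c\<close>; conjugation then carries
  \<open>spike i c\<close> to \<open>spike j c\<close> for every index \<open>j\<close> (\<open>spike_chained\<close>).  Thus all nontrivial normal
  filters of the kite share \<open>spike j c\<close>.

  Conversely, let \<open>F\<close> be a normal filter of \<open>G\<close> and \<open>C\<close> a union of orbits of the partial map
  \<open>lam\<close>.  The level \<open>0\<close> elements with all values in \<open>F\<close> and equal to the unit outside \<open>C\<close> form a
  normal filter of the kite (\<open>supported_filter_normal\<close>).  A non-unit common to all nontrivial
  normal filters of the kite belongs to these.  Varying \<open>F\<close>, any of its non-unit coordinates
  lies in every nontrivial normal filter of \<open>G\<close>; varying \<open>C\<close>, the index of such a coordinate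
  lies in the orbit of every index, so there is a single orbit.
\<close>

section \<open>Normal filters and congruences of integral residuated lattices\<close>

text \<open>The last clause is closure under left and right conjugation; it plays the part that normality
plays for subgroups.\<close>

definition normal_filter :: "('a, 'm) residuated_lattice_scheme \<Rightarrow> 'a set \<Rightarrow> bool"
  where "normal_filter L F \<longleftrightarrow> F \<subseteq> carrier L \<and> \<one>\<^bsub>L\<^esub> \<in> F \<and>
    (\<forall>x\<in>F. \<forall>y\<in>carrier L. x \<preceq>\<^bsub>L\<^esub> y \<longrightarrow> y \<in> F) \<and>
    (\<forall>x\<in>F. \<forall>y\<in>F. x \<otimes>\<^bsub>L\<^esub> y \<in> F) \<and>
    (\<forall>x\<in>F. \<forall>a\<in>carrier L. ldiv L a (x \<otimes>\<^bsub>L\<^esub> a) \<in> F \<and> rdiv L (a \<otimes>\<^bsub>L\<^esub> x) a \<in> F)"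

lemma normal_filterD:
  assumes "normal_filter L F"
  shows "F \<subseteq> carrier L"
    and "\<one>\<^bsub>L\<^esub> \<in> F"
    and "\<lbrakk>x \<in> F; y \<in> carrier L; x \<preceq>\<^bsub>L\<^esub> y\<rbrakk> \<Longrightarrow> y \<in> F"
    and "\<lbrakk>x \<in> F; y \<in> F\<rbrakk> \<Longrightarrow> x \<otimes>\<^bsub>L\<^esub> y \<in> F"
    and "\<lbrakk>x \<in> F; a \<in> carrier L\<rbrakk> \<Longrightarrow> ldiv L a (x \<otimes>\<^bsub>L\<^esub> a) \<in> F"
    and "\<lbrakk>x \<in> F; a \<in> carrier L\<rbrakk> \<Longrightarrow> rdiv L (a \<otimes>\<^bsub>L\<^esub> x) a \<in> F"
  using assms unfolding normal_filter_def by blast+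

text \<open>The order modulo \<open>F\<close>: for a normal filter of an integral residuated lattice this is the order
of the quotient, pulled back to representatives.  Defining the congruence through it reduces
compatibility with each operation to monotonicity.\<close>

definition filter_le :: "('a, 'm) residuated_lattice_scheme \<Rightarrow> 'a set \<Rightarrow> 'a \<Rightarrow> 'a \<Rightarrow> bool"
  where "filter_le L F x y \<longleftrightarrow> (\<exists>f\<in>F. f \<otimes>\<^bsub>L\<^esub> x \<preceq>\<^bsub>L\<^esub> y)"

definition filter_congruence ::
    "('a, 'm) residuated_lattice_scheme \<Rightarrow> 'a set \<Rightarrow> ('a \<times> 'a) set"
  where "filter_congruence L F =
    {(x, y). x \<in> carrier L \<and> y \<in> carrier L \<and> filter_le L F x y \<and> filter_le L F y x}"

lemma rl_congruence_equiv: "rl_congruence L \<theta> \<Longrightarrow> equiv (carrier L) \<theta>"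
  by (simp add: rl_congruence_def)

lemma rl_congruence_refl: "\<lbrakk>rl_congruence L \<theta>; x \<in> carrier L\<rbrakk> \<Longrightarrow> (x, x) \<in> \<theta>"
  using rl_congruence_equiv by (fastforce simp: equiv_def refl_on_def)

lemma rl_congruence_closed:
  "\<lbrakk>rl_congruence L \<theta>; (x, y) \<in> \<theta>\<rbrakk> \<Longrightarrow> x \<in> carrier L \<and> y \<in> carrier L"
  using equiv_type[OF rl_congruence_equiv] by blast

lemma rl_congruence_op:
  assumes "rl_congruence L \<theta>" "(x, x') \<in> \<theta>" "(y, y') \<in> \<theta>"
  shows "(x \<otimes>\<^bsub>L\<^esub> y, x' \<otimes>\<^bsub>L\<^esub> y') \<in> \<theta>"
    and "(x \<curlywedge>\<^bsub>L\<^esub> y, x' \<curlywedge>\<^bsub>L\<^esub> y') \<in> \<theta>"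
    and "(x \<curlyvee>\<^bsub>L\<^esub> y, x' \<curlyvee>\<^bsub>L\<^esub> y') \<in> \<theta>"
    and "(ldiv L x y, ldiv L x' y') \<in> \<theta>"
    and "(rdiv L x y, rdiv L x' y') \<in> \<theta>"
  using assms unfolding rl_congruence_def by simp_all

lemma rl_congruence_Inter:
  assumes T: "\<And>\<theta>. \<theta> \<in> T \<Longrightarrow> rl_congruence L \<theta>" and ne: "T \<noteq> {}"
  shows "rl_congruence L (\<Inter>T)"
  unfolding rl_congruence_def
proof (intro conjI ballI allI impI)
  show "equiv (carrier L) (\<Inter>T)"
  proof (rule equivI)
    obtain \<theta> where th: "\<theta> \<in> T" using ne by blast
    show "\<Inter>T \<subseteq> carrier L \<times> carrier L"
      using equiv_type[OF rl_congruence_equiv[OF T[OF th]]] th by blast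
    show "refl_on (carrier L) (\<Inter>T)"
      using rl_congruence_refl[OF T] by (simp add: refl_on_def)
    show "sym (\<Inter>T)"
      using rl_congruence_equiv[OF T] by (auto simp: equiv_def sym_def)
    show "trans (\<Inter>T)"
      unfolding trans_def
    proof (intro allI impI InterI)
      fix x y z \<theta> assume "(x, y) \<in> \<Inter>T" "(y, z) \<in> \<Inter>T" "\<theta> \<in> T"
      moreover from this have "trans \<theta>" using rl_congruence_equiv[OF T] by (simp add: equiv_def)
      ultimately show "(x, z) \<in> \<theta>" by (meson InterD transD)
    qed
  qed
next
  fix f x x' y y'
  assume f: "f \<in> {mult L, rmeet L, rjoin L, ldiv L, rdiv L}"
    and xy: "(x, x') \<in> \<Inter>T" "(y, y') \<in> \<Inter>T"
  show "(f x y, f x' y') \<in> \<Inter>T"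
  proof
    fix \<theta> assume th: "\<theta> \<in> T"
    have "(x, x') \<in> \<theta>" "(y, y') \<in> \<theta>" using xy th by auto
    from rl_congruence_op[OF T[OF th] this] show "(f x y, f x' y') \<in> \<theta>" using f by auto
  qed
qed

context residuated_lattice
begin

lemma mult_mono_left:
  assumes "x \<in> carrier L" "y \<in> carrier L" "z \<in> carrier L" "x \<preceq> y"
  shows "x \<otimes> z \<preceq> y \<otimes> z"
proof -
  have "y \<preceq> rdiv L (y \<otimes> z) z"
    using assms by (simp add: rdiv_resid[symmetric] le_refl)
  then have "x \<preceq> rdiv L (y \<otimes> z) z"
    using le_trans[of x y "rdiv L (y \<otimes> z) z"] assms by (simp add: rdiv_closed)
  then show ?thesis using assms by (simp add: rdiv_resid)
qed

lemma mult_mono_right: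
  assumes "x \<in> carrier L" "y \<in> carrier L" "z \<in> carrier L" "x \<preceq> y"
  shows "z \<otimes> x \<preceq> z \<otimes> y"
proof -
  have "y \<preceq> ldiv L z (z \<otimes> y)"
    using assms by (simp add: ldiv_resid[symmetric] le_refl)
  then have "x \<preceq> ldiv L z (z \<otimes> y)"
    using le_trans[of x y "ldiv L z (z \<otimes> y)"] assms by (simp add: ldiv_closed)
  then show ?thesis using assms by (simp add: ldiv_resid)
qed

lemma ldiv_cancel:
  "\<lbrakk>x \<in> carrier L; y \<in> carrier L\<rbrakk> \<Longrightarrow> x \<otimes> ldiv L x y \<preceq> y"
  by (simp add: ldiv_resid ldiv_closed le_refl)

lemma rdiv_cancel:
  "\<lbrakk>x \<in> carrier L; y \<in> carrier L\<rbrakk> \<Longrightarrow> rdiv L y x \<otimes> x \<preceq> y"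
  by (simp add: rdiv_resid rdiv_closed le_refl)

end

context integral_residuated_lattice
begin

lemma mult_le1: "\<lbrakk>x \<in> carrier L; y \<in> carrier L\<rbrakk> \<Longrightarrow> x \<otimes> y \<preceq> x"
  using mult_mono_right[of y \<one> x] integral by simp

lemma mult_le2: "\<lbrakk>x \<in> carrier L; y \<in> carrier L\<rbrakk> \<Longrightarrow> x \<otimes> y \<preceq> y"
  using mult_mono_left[of x \<one> y] integral by simp

lemma ldiv_eq_one:
  assumes "x \<in> carrier L" "y \<in> carrier L"
  shows "ldiv L x y = \<one> \<longleftrightarrow> x \<preceq> y"
proof -
  have "x \<preceq> y \<longleftrightarrow> \<one> \<preceq> ldiv L x y" using assms ldiv_resid[of x \<one> y] by simp
  then show ?thesis
    using le_antisym[of "ldiv L x y" \<one>] integral ldiv_closed le_refl assms by auto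
qed

lemma rdiv_eq_one:
  assumes "x \<in> carrier L" "y \<in> carrier L"
  shows "rdiv L y x = \<one> \<longleftrightarrow> x \<preceq> y"
proof -
  have "x \<preceq> y \<longleftrightarrow> \<one> \<preceq> rdiv L y x" using assms rdiv_resid[of \<one> x y] by simp
  then show ?thesis
    using le_antisym[of "rdiv L y x" \<one>] integral rdiv_closed le_refl assms by auto
qed

lemma one_ldiv:
  assumes "x \<in> carrier L"
  shows "ldiv L \<one> x = x"
proof (rule le_antisym)
  show "ldiv L \<one> x \<preceq> x" using ldiv_cancel[of \<one> x] assms by (simp add: ldiv_closed)
  show "x \<preceq> ldiv L \<one> x" using ldiv_resid[of \<one> x x] assms by (simp add: le_refl)
qed (use assms ldiv_closed in auto)

lemma rdiv_one:
  assumes "x \<in> carrier L"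
  shows "rdiv L x \<one> = x"
proof (rule le_antisym)
  show "rdiv L x \<one> \<preceq> x" using rdiv_cancel[of \<one> x] assms by (simp add: rdiv_closed)
  show "x \<preceq> rdiv L x \<one>" using rdiv_resid[of x \<one> x] assms by (simp add: le_refl)
qed (use assms rdiv_closed in auto)

lemma normal_filter_carrier: "normal_filter L (carrier L)"
  unfolding normal_filter_def by (simp add: ldiv_closed rdiv_closed)

text \<open>Normality lets a filter element pass from one side of a factor to the other, at the cost of
  replacing it by a conjugate.\<close>

lemma filter_shift_left:
  assumes "normal_filter L F" "f \<in> F" "x \<in> carrier L"
  shows "\<exists>g\<in>F. g \<otimes> x \<preceq> x \<otimes> f"
proof
  show "rdiv L (x \<otimes> f) x \<in> F" by (rule normal_filterD(6)[OF assms])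
  show "rdiv L (x \<otimes> f) x \<otimes> x \<preceq> x \<otimes> f"
    using assms normal_filterD(1)[OF assms(1)] by (intro rdiv_cancel) auto
qed

lemma filter_shift_right:
  assumes "normal_filter L F" "f \<in> F" "x \<in> carrier L"
  shows "\<exists>g\<in>F. x \<otimes> g \<preceq> f \<otimes> x"
proof
  show "ldiv L x (f \<otimes> x) \<in> F" by (rule normal_filterD(5)[OF assms])
  show "x \<otimes> ldiv L x (f \<otimes> x) \<preceq> f \<otimes> x"
    using assms normal_filterD(1)[OF assms(1)] by (intro ldiv_cancel) auto
qed

lemma filter_le_right_iff:
  assumes F: "normal_filter L F" and xy: "x \<in> carrier L" "y \<in> carrier L"
  shows "filter_le L F x y \<longleftrightarrow> (\<exists>f\<in>F. x \<otimes> f \<preceq> y)"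
proof
  assume "filter_le L F x y"
  then obtain f g where "f \<in> F" "f \<otimes> x \<preceq> y" "g \<in> F" "x \<otimes> g \<preceq> f \<otimes> x"
    unfolding filter_le_def using filter_shift_right[OF F] xy by metis
  then show "\<exists>f\<in>F. x \<otimes> f \<preceq> y"
    using normal_filterD(1)[OF F] xy le_trans[of "x \<otimes> g" "f \<otimes> x" y] by blast
next
  assume "\<exists>f\<in>F. x \<otimes> f \<preceq> y"
  then obtain f g where "f \<in> F" "x \<otimes> f \<preceq> y" "g \<in> F" "g \<otimes> x \<preceq> x \<otimes> f"
    using filter_shift_left[OF F] xy by metis
  then show "filter_le L F x y"
    unfolding filter_le_def
    using normal_filterD(1)[OF F] xy le_trans[of "g \<otimes> x" "x \<otimes> f" y] by blast
qed

text \<open>The order modulo a filter may be tested with filter elements on both sides: the right one is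
shifted across and absorbed into the left one.\<close>

lemma filter_leI_sandwich:
  assumes F: "normal_filter L F" and xy: "x \<in> carrier L" "y \<in> carrier L"
    and fg: "f \<in> F" "g \<in> F" and le: "f \<otimes> x \<otimes> g \<preceq> y"
  shows "filter_le L F x y"
proof -
  obtain h where h: "h \<in> F" "h \<otimes> x \<preceq> x \<otimes> g"
    using filter_shift_left[OF F] fg xy by blast
  have c: "f \<in> carrier L" "g \<in> carrier L" "h \<in> carrier L"
    using normal_filterD(1)[OF F] fg h by auto
  have "(f \<otimes> h) \<otimes> x \<preceq> f \<otimes> x \<otimes> g"
    using mult_mono_right[of "h \<otimes> x" "x \<otimes> g" f] h c xy by (simp add: m_assoc)
  then have "(f \<otimes> h) \<otimes> x \<preceq> y"
    using le_trans[of "(f \<otimes> h) \<otimes> x" "f \<otimes> x \<otimes> g" y] le c xy by simp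
  then show ?thesis unfolding filter_le_def using normal_filterD(4)[OF F] fg h by blast
qed

lemma filter_le_refl:
  "\<lbrakk>normal_filter L F; x \<in> carrier L\<rbrakk> \<Longrightarrow> filter_le L F x x"
  unfolding filter_le_def by (rule bexI[of _ \<one>]) (auto simp: le_refl normal_filterD(2))

lemma filter_le_trans:
  assumes F: "normal_filter L F" and c: "x \<in> carrier L" "y \<in> carrier L" "z \<in> carrier L"
    and "filter_le L F x y" "filter_le L F y z"
  shows "filter_le L F x z"
proof -
  obtain f g where fg: "f \<in> F" "f \<otimes> x \<preceq> y" "g \<in> F" "g \<otimes> y \<preceq> z"
    using assms unfolding filter_le_def by blast
  then have fgc: "f \<in> carrier L" "g \<in> carrier L" using normal_filterD(1)[OF F] by auto
  have "(g \<otimes> f) \<otimes> x \<preceq> g \<otimes> y"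
    using mult_mono_right[of "f \<otimes> x" y g] fg fgc c by (simp add: m_assoc)
  then have "(g \<otimes> f) \<otimes> x \<preceq> z"
    using le_trans[of "(g \<otimes> f) \<otimes> x" "g \<otimes> y" z] fg fgc c by simp
  then show ?thesis unfolding filter_le_def using normal_filterD(4)[OF F] fg by blast
qed

lemma filter_le_mult:
  assumes F: "normal_filter L F"
    and c: "x \<in> carrier L" "x' \<in> carrier L" "y \<in> carrier L" "y' \<in> carrier L"
    and "filter_le L F x x'" "filter_le L F y y'"
  shows "filter_le L F (x \<otimes> y) (x' \<otimes> y')"
proof -
  obtain f g where fg: "f \<in> F" "f \<otimes> x \<preceq> x'" "g \<in> F" "y \<otimes> g \<preceq> y'"
    using assms filter_le_right_iff[OF F c(3,4)] unfolding filter_le_def by blast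
  then have fgc: "f \<in> carrier L" "g \<in> carrier L" using normal_filterD(1)[OF F] by auto
  have "f \<otimes> x \<otimes> (y \<otimes> g) \<preceq> x' \<otimes> (y \<otimes> g)" "x' \<otimes> (y \<otimes> g) \<preceq> x' \<otimes> y'"
    using fg fgc c by (auto intro!: mult_mono_left mult_mono_right)
  then have "f \<otimes> x \<otimes> (y \<otimes> g) \<preceq> x' \<otimes> y'"
    using le_trans[of "f \<otimes> x \<otimes> (y \<otimes> g)" "x' \<otimes> (y \<otimes> g)" "x' \<otimes> y'"] fgc c by simp
  then show ?thesis
    using filter_leI_sandwich[OF F _ _ fg(1,3), of "x \<otimes> y"] fgc c by (simp add: m_assoc)
qed

text \<open>One filter element serves two inequalities at once, because a product lies below both
  of its factors in an integral residuated lattice.\<close>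

lemma filter_le_common:
  assumes F: "normal_filter L F"
    and c: "x \<in> carrier L" "x' \<in> carrier L" "y \<in> carrier L" "y' \<in> carrier L"
    and "filter_le L F x x'" "filter_le L F y y'"
  shows "\<exists>f\<in>F. f \<otimes> x \<preceq> x' \<and> f \<otimes> y \<preceq> y'"
proof -
  obtain f g where fg: "f \<in> F" "f \<otimes> x \<preceq> x'" "g \<in> F" "g \<otimes> y \<preceq> y'"
    using assms unfolding filter_le_def by blast
  then have fgc: "f \<in> carrier L" "g \<in> carrier L" using normal_filterD(1)[OF F] by auto
  have "f \<otimes> g \<otimes> x \<preceq> f \<otimes> x" "f \<otimes> g \<otimes> y \<preceq> g \<otimes> y"
    using fgc c by (auto intro!: mult_mono_left mult_le1 mult_le2)
  then have "f \<otimes> g \<otimes> x \<preceq> x'" "f \<otimes> g \<otimes> y \<preceq> y'"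
    using le_trans[of "f \<otimes> g \<otimes> x" "f \<otimes> x" x'] le_trans[of "f \<otimes> g \<otimes> y" "g \<otimes> y" y'] fg fgc c
    by simp_all
  then show ?thesis using normal_filterD(4)[OF F] fg by blast
qed

lemma filter_le_meet:
  assumes F: "normal_filter L F"
    and c: "x \<in> carrier L" "x' \<in> carrier L" "y \<in> carrier L" "y' \<in> carrier L"
    and "filter_le L F x x'" "filter_le L F y y'"
  shows "filter_le L F (x \<curlywedge> y) (x' \<curlywedge> y')"
proof -
  obtain f where f: "f \<in> F" "f \<otimes> x \<preceq> x'" "f \<otimes> y \<preceq> y'"
    using filter_le_common[OF assms] by blast
  then have fc: "f \<in> carrier L" using normal_filterD(1)[OF F] by auto
  have "f \<otimes> (x \<curlywedge> y) \<preceq> f \<otimes> x" "f \<otimes> (x \<curlywedge> y) \<preceq> f \<otimes> y"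
    using fc c by (auto intro!: mult_mono_right meet_le1 meet_le2 meet_closed)
  then have "f \<otimes> (x \<curlywedge> y) \<preceq> x'" "f \<otimes> (x \<curlywedge> y) \<preceq> y'"
    using le_trans[of "f \<otimes> (x \<curlywedge> y)" "f \<otimes> x" x'] le_trans[of "f \<otimes> (x \<curlywedge> y)" "f \<otimes> y" y'] f fc c
    by (simp_all add: meet_closed)
  then show ?thesis unfolding filter_le_def
    using f(1) fc c by (blast intro: le_meetI m_closed meet_closed)
qed

lemma filter_le_join:
  assumes F: "normal_filter L F"
    and c: "x \<in> carrier L" "x' \<in> carrier L" "y \<in> carrier L" "y' \<in> carrier L"
    and "filter_le L F x x'" "filter_le L F y y'"
  shows "filter_le L F (x \<curlyvee> y) (x' \<curlyvee> y')"
proof -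
  obtain f where f: "f \<in> F" "f \<otimes> x \<preceq> x'" "f \<otimes> y \<preceq> y'"
    using filter_le_common[OF assms] by blast
  then have fc: "f \<in> carrier L" using normal_filterD(1)[OF F] by auto
  have "f \<otimes> x \<preceq> x' \<curlyvee> y'" "f \<otimes> y \<preceq> x' \<curlyvee> y'"
    using le_trans[of "f \<otimes> x" x' "x' \<curlyvee> y'"] le_trans[of "f \<otimes> y" y' "x' \<curlyvee> y'"] f fc c
    by (simp_all add: join_closed join_ge1 join_ge2)
  then have "x \<preceq> ldiv L f (x' \<curlyvee> y')" "y \<preceq> ldiv L f (x' \<curlyvee> y')"
    using fc c by (simp_all add: ldiv_resid join_closed)
  then have "f \<otimes> (x \<curlyvee> y) \<preceq> x' \<curlyvee> y'"
    using fc c by (simp add: ldiv_resid join_closed join_leI ldiv_closed)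
  then show ?thesis unfolding filter_le_def using f(1) by blast
qed

text \<open>If \<open>x' \<otimes> f \<preceq> x\<close> and \<open>y \<otimes> g \<preceq> y'\<close>, then multiplying \<open>ldiv L x y\<close> by \<open>f\<close> on the left and by \<open>g\<close>
on the right gives an element that \<open>x'\<close> multiplies below \<open>y'\<close>.  The case of right division is
the mirror image.\<close>

lemma filter_le_ldiv:
  assumes F: "normal_filter L F"
    and c: "x \<in> carrier L" "x' \<in> carrier L" "y \<in> carrier L" "y' \<in> carrier L"
    and "filter_le L F x' x" "filter_le L F y y'"
  shows "filter_le L F (ldiv L x y) (ldiv L x' y')"
proof -
  obtain f g where fg: "f \<in> F" "x' \<otimes> f \<preceq> x" "g \<in> F" "y \<otimes> g \<preceq> y'"
    using assms filter_le_right_iff[OF F] by meson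
  then have fgc: "f \<in> carrier L" "g \<in> carrier L" using normal_filterD(1)[OF F] by auto
  let ?d = "ldiv L x y"
  have d: "?d \<in> carrier L" using c ldiv_closed by blast
  have "x' \<otimes> f \<otimes> ?d \<preceq> x \<otimes> ?d" "x \<otimes> ?d \<preceq> y"
    using fg fgc c d by (auto intro!: mult_mono_left ldiv_cancel)
  then have "x' \<otimes> f \<otimes> ?d \<preceq> y"
    using le_trans[of "x' \<otimes> f \<otimes> ?d" "x \<otimes> ?d" y] fgc c d by simp
  then have "x' \<otimes> f \<otimes> ?d \<otimes> g \<preceq> y \<otimes> g" using fgc c d by (simp add: mult_mono_left)
  then have "x' \<otimes> f \<otimes> ?d \<otimes> g \<preceq> y'"
    using le_trans[of "x' \<otimes> f \<otimes> ?d \<otimes> g" "y \<otimes> g" y'] fg fgc c d by simp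
  then have "f \<otimes> ?d \<otimes> g \<preceq> ldiv L x' y'"
    using fgc c d by (simp add: ldiv_resid[symmetric] m_assoc)
  then show ?thesis using filter_leI_sandwich[OF F d ldiv_closed fg(1,3)] c by blast
qed

lemma filter_le_rdiv:
  assumes F: "normal_filter L F"
    and c: "x \<in> carrier L" "x' \<in> carrier L" "y \<in> carrier L" "y' \<in> carrier L"
    and "filter_le L F x' x" "filter_le L F y y'"
  shows "filter_le L F (rdiv L y x) (rdiv L y' x')"
proof -
  obtain f g where fg: "f \<in> F" "f \<otimes> x' \<preceq> x" "g \<in> F" "g \<otimes> y \<preceq> y'"
    using assms unfolding filter_le_def by blast
  then have fgc: "f \<in> carrier L" "g \<in> carrier L" using normal_filterD(1)[OF F] by auto
  let ?d = "rdiv L y x"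
  have d: "?d \<in> carrier L" using c rdiv_closed by blast
  have "?d \<otimes> (f \<otimes> x') \<preceq> ?d \<otimes> x" "?d \<otimes> x \<preceq> y"
    using fg fgc c d by (auto intro!: mult_mono_right rdiv_cancel)
  then have "?d \<otimes> (f \<otimes> x') \<preceq> y"
    using le_trans[of "?d \<otimes> (f \<otimes> x')" "?d \<otimes> x" y] fgc c d by simp
  then have "g \<otimes> (?d \<otimes> (f \<otimes> x')) \<preceq> g \<otimes> y" using fgc c d by (simp add: mult_mono_right)
  then have "g \<otimes> (?d \<otimes> (f \<otimes> x')) \<preceq> y'"
    using le_trans[of "g \<otimes> (?d \<otimes> (f \<otimes> x'))" "g \<otimes> y" y'] fg fgc c d by simp
  then have "g \<otimes> ?d \<otimes> f \<preceq> rdiv L y' x'"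
    using fgc c d by (simp add: rdiv_resid[symmetric] m_assoc)
  then show ?thesis using filter_leI_sandwich[OF F d rdiv_closed fg(3,1)] c by blast
qed

lemma filter_congruence_is_congruence:
  assumes F: "normal_filter L F"
  shows "rl_congruence L (filter_congruence L F)"
  unfolding rl_congruence_def
proof (intro conjI)
  show "equiv (carrier L) (filter_congruence L F)"
    by (rule equivI)
      (auto simp: filter_congruence_def refl_on_def sym_def trans_def
        intro: filter_le_refl[OF F] filter_le_trans[OF F])
  show "\<forall>f \<in> {mult L, rmeet L, rjoin L, ldiv L, rdiv L}. \<forall>x x' y y'.
      (x, x') \<in> filter_congruence L F \<longrightarrow> (y, y') \<in> filter_congruence L F \<longrightarrow>
      (f x y, f x' y') \<in> filter_congruence L F"
    by (auto simp: filter_congruence_def meet_closed join_closed ldiv_closed rdiv_closed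
        intro: filter_le_mult[OF F] filter_le_meet[OF F] filter_le_join[OF F]
          filter_le_ldiv[OF F] filter_le_rdiv[OF F])
qed

lemma filter_congruence_one_class:
  assumes F: "normal_filter L F"
  shows "(x, \<one>) \<in> filter_congruence L F \<longleftrightarrow> x \<in> F"
proof
  assume "(x, \<one>) \<in> filter_congruence L F"
  then obtain f where "x \<in> carrier L" "f \<in> F" "f \<otimes> \<one> \<preceq> x"
    by (auto simp: filter_congruence_def filter_le_def)
  then show "x \<in> F" using normal_filterD(1,3)[OF F] by (metis r_one subsetD)
next
  assume x: "x \<in> F"
  then have xc: "x \<in> carrier L" using normal_filterD(1)[OF F] by blast
  have "filter_le L F x \<one>" unfolding filter_le_def
    using xc x by (auto intro!: bexI[of _ x] integral)
  moreover have "filter_le L F \<one> x" unfolding filter_le_def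
    using xc x by (auto intro!: bexI[of _ x] le_refl)
  ultimately show "(x, \<one>) \<in> filter_congruence L F"
    using xc by (simp add: filter_congruence_def)
qed

lemma one_class_normal_filter:
  assumes th: "rl_congruence L \<theta>"
  shows "normal_filter L {x. (x, \<one>) \<in> \<theta>}"
proof -
  note refl = rl_congruence_refl[OF th] and closed = rl_congruence_closed[OF th]
    and cong = rl_congruence_op[OF th]
  define F where "F = {x. (x, \<one>) \<in> \<theta>}"
  have F: "x \<in> F \<longleftrightarrow> (x, \<one>) \<in> \<theta>" for x by (simp add: F_def)
  have "normal_filter L F" unfolding normal_filter_def
  proof (intro conjI ballI impI subsetI)
    fix x assume "x \<in> F"
    then show "x \<in> carrier L" using closed F by blast
  next
    show "\<one> \<in> F" by (simp add: refl F)
  next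
    fix x y assume "x \<in> F" and y: "y \<in> carrier L" "x \<preceq> y"
    then have x: "(x, \<one>) \<in> \<theta>" by (simp add: F)
    have "(x \<curlyvee> y, \<one> \<curlyvee> y) \<in> \<theta>" by (rule cong(3)[OF x refl[OF y(1)]])
    moreover have "x \<curlyvee> y = y" using y closed[OF x] le_iff_join[of x y] by simp
    moreover have "\<one> \<curlyvee> y = \<one>"
      using integral[OF y(1)] y le_iff_join[of y \<one>] join_comm[of y \<one>] by simp
    ultimately show "y \<in> F" by (simp add: F)
  next
    fix x y assume "x \<in> F" "y \<in> F"
    then show "x \<otimes> y \<in> F" using cong(1)[of x \<one> y \<one>] by (simp add: F)
  next
    fix x a assume "x \<in> F" and a: "a \<in> carrier L"
    then have x: "(x, \<one>) \<in> \<theta>" by (simp add: F)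
    have "(x \<otimes> a, a) \<in> \<theta>" using cong(1)[OF x refl[OF a]] a by simp
    from cong(4)[OF refl[OF a] this] show "ldiv L a (x \<otimes> a) \<in> F"
      using ldiv_eq_one[OF a a] le_refl[OF a] by (simp add: F)
    have "(a \<otimes> x, a) \<in> \<theta>" using cong(1)[OF refl[OF a] x] a by simp
    from cong(5)[OF this refl[OF a]] show "rdiv L (a \<otimes> x) a \<in> F"
      using rdiv_eq_one[OF a a] le_refl[OF a] by (simp add: F)
  qed
  then show ?thesis by (simp add: F_def)
qed

text \<open>A pair of distinct congruent elements yields a non-unit in the class of the unit: both left
quotients of the pair are congruent to the unit, and they are both equal to it only if each
element lies below the other.\<close>

lemma one_class_nontrivial:
  assumes th: "rl_congruence L \<theta>" and ne: "\<theta> \<noteq> Id_on (carrier L)"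
  shows "\<exists>c. (c, \<one>) \<in> \<theta> \<and> c \<noteq> \<one>"
proof -
  have "Id_on (carrier L) \<subseteq> \<theta>" using rl_congruence_refl[OF th] by auto
  then obtain x y where xy: "(x, y) \<in> \<theta>" "(x, y) \<notin> Id_on (carrier L)" using ne by auto
  have c: "x \<in> carrier L" "y \<in> carrier L" using rl_congruence_closed[OF th xy(1)] by auto
  then have "x \<noteq> y" using xy(2) by auto
  have refl: "(x, x) \<in> \<theta>" "(y, y) \<in> \<theta>" using rl_congruence_refl[OF th] c by auto
  have "(ldiv L x y, \<one>) \<in> \<theta>" "(ldiv L y x, \<one>) \<in> \<theta>"
    using rl_congruence_op(4)[OF th xy(1) refl(2)] rl_congruence_op(4)[OF th refl(2) xy(1)]
      ldiv_eq_one[OF c(2) c(2)] le_refl[OF c(2)] by simp_all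
  moreover have "ldiv L x y \<noteq> \<one> \<or> ldiv L y x \<noteq> \<one>"
    using \<open>x \<noteq> y\<close> le_antisym[OF c] ldiv_eq_one[OF c] ldiv_eq_one[OF c(2) c(1)] by auto
  ultimately show ?thesis by blast
qed

text \<open>Passing between congruences and their unit classes, a least nontrivial congruence exists as
soon as the intersection of all nontrivial ones is itself nontrivial.\<close>

lemma subdirectly_irreducible_iff:
  "subdirectly_irreducible L \<longleftrightarrow>
    (\<exists>c\<in>carrier L. c \<noteq> \<one> \<and> (\<forall>F. normal_filter L F \<longrightarrow> F \<noteq> {\<one>} \<longrightarrow> c \<in> F))"
proof
  assume "subdirectly_irreducible L"
  then obtain \<mu> where mu: "rl_congruence L \<mu>" "\<mu> \<noteq> Id_on (carrier L)"
    and least: "\<forall>\<theta>. rl_congruence L \<theta> \<and> \<theta> \<noteq> Id_on (carrier L) \<longrightarrow> \<mu> \<subseteq> \<theta>"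
    unfolding subdirectly_irreducible_def by auto
  obtain c where c: "(c, \<one>) \<in> \<mu>" "c \<noteq> \<one>" using one_class_nontrivial[OF mu] by auto
  have "c \<in> F" if F: "normal_filter L F" "F \<noteq> {\<one>}" for F
  proof -
    obtain f where f: "f \<in> F" "f \<noteq> \<one>" using F(2) normal_filterD(2)[OF F(1)] by auto
    have "(f, \<one>) \<in> filter_congruence L F" using filter_congruence_one_class[OF F(1)] f by simp
    then have "filter_congruence L F \<noteq> Id_on (carrier L)" using f(2) by (metis Id_onE prod.inject)
    then have "\<mu> \<subseteq> filter_congruence L F"
      using least filter_congruence_is_congruence[OF F(1)] by simp
    then show "c \<in> F" using c(1) filter_congruence_one_class[OF F(1), of c] by auto
  qed
  then show "\<exists>c\<in>carrier L. c \<noteq> \<one> \<and> (\<forall>F. normal_filter L F \<longrightarrow> F \<noteq> {\<one>} \<longrightarrow> c \<in> F)"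
    using c rl_congruence_closed[OF mu(1) c(1)] by auto
next
  assume "\<exists>c\<in>carrier L. c \<noteq> \<one> \<and> (\<forall>F. normal_filter L F \<longrightarrow> F \<noteq> {\<one>} \<longrightarrow> c \<in> F)"
  then obtain c where c: "c \<in> carrier L" "c \<noteq> \<one>"
    and cF: "\<forall>F. normal_filter L F \<longrightarrow> F \<noteq> {\<one>} \<longrightarrow> c \<in> F" by auto
  define T where "T = {\<theta>. rl_congruence L \<theta> \<and> \<theta> \<noteq> Id_on (carrier L)}"
  have c_rel: "(c, \<one>) \<in> \<theta>" if "\<theta> \<in> T" for \<theta>
  proof -
    have th: "rl_congruence L \<theta>" "\<theta> \<noteq> Id_on (carrier L)" using that by (auto simp: T_def)
    have "{x. (x, \<one>) \<in> \<theta>} \<noteq> {\<one>}" using one_class_nontrivial[OF th] by auto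
    from cF[rule_format, OF one_class_normal_filter[OF th(1)] this] show ?thesis by simp
  qed
  have "(c, \<one>) \<in> filter_congruence L (carrier L)"
    using filter_congruence_one_class[OF normal_filter_carrier] c by simp
  then have "filter_congruence L (carrier L) \<noteq> Id_on (carrier L)"
    using c(2) by (metis Id_onE prod.inject)
  then have ne: "T \<noteq> {}"
    using filter_congruence_is_congruence[OF normal_filter_carrier] by (auto simp: T_def)
  have "rl_congruence L (\<Inter>T)" by (rule rl_congruence_Inter[OF _ ne]) (simp add: T_def)
  moreover have "\<Inter>T \<noteq> Id_on (carrier L)"
  proof
    assume "\<Inter>T = Id_on (carrier L)"
    moreover have "(c, \<one>) \<in> \<Inter>T" using c_rel by simp
    ultimately show False using c(2) by auto
  qed
  moreover have "\<forall>\<theta>. rl_congruence L \<theta> \<and> \<theta> \<noteq> Id_on (carrier L) \<longrightarrow> \<Inter>T \<subseteq> \<theta>"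
    by (auto simp: T_def)
  moreover have "nontrivial L" using c by (auto simp: nontrivial_def)
  ultimately show "subdirectly_irreducible L"
    unfolding subdirectly_irreducible_def using residuated_lattice_axioms by blast
qed

end

section \<open>Normal filters of kites\<close>

context kite_data
begin

definition spike :: "'i \<Rightarrow> 'a \<Rightarrow> ('i, 'a) kite_elem"
  where "spike i g = (0, \<lambda>j\<in>I0. if j = i then g else \<one>)"

lemma spike_closed: "g \<in> carrier G \<Longrightarrow> spike i g \<in> carrier K"
  by (simp add: spike_def kite_carrier_iff)

lemma spike_one: "spike i \<one> = \<one>\<^bsub>K\<^esub>"
  by (simp add: spike_def kite_one_def)

lemma spike_eq_one: "i \<in> I0 \<Longrightarrow> spike i g = \<one>\<^bsub>K\<^esub> \<longleftrightarrow> g = \<one>"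
  by (auto simp: spike_def kite_one_def fun_eq_iff)

lemma spike_le: "\<lbrakk>g \<in> carrier G; h \<in> carrier G; g \<preceq> h\<rbrakk> \<Longrightarrow> spike i g \<preceq>\<^bsub>K\<^esub> spike i h"
  using spike_closed[of g i] spike_closed[of h i]
  by (simp add: spike_def kite_le_iff le_refl del: kite_ops)

lemma spike_mult:
  "\<lbrakk>g \<in> carrier G; h \<in> carrier G\<rbrakk> \<Longrightarrow> spike i g \<otimes>\<^bsub>K\<^esub> spike i h = spike i (g \<otimes> h)"
  by (auto simp: spike_def)

lemma spike_ldiv:
  "\<lbrakk>g \<in> carrier G; h \<in> carrier G\<rbrakk> \<Longrightarrow> ldiv K (spike i g) (spike i h) = spike i (ldiv G g h)"
  by (auto simp: spike_def one_ldiv)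

lemma spike_rdiv:
  assumes "g \<in> carrier G" "h \<in> carrier G"
  shows "rdiv K (spike i g) (spike i h) = spike i (rdiv G g h)"
proof -
  have "inv_into (J 0) (lam ^^ 0) j = j" if "j \<in> I0" for j
    using inv_iter[of 0 0 j] that by simp
  then show ?thesis using assms by (auto simp: spike_def rdiv_one fun_eq_iff restrict_def)
qed

lemma spike_filter:
  assumes F: "normal_filter K F"
  shows "normal_filter G {g \<in> carrier G. spike i g \<in> F}"
  unfolding normal_filter_def
proof (intro conjI ballI impI; (elim CollectE conjE)?; (intro CollectI conjI)?)
  show "spike i \<one> \<in> F" using normal_filterD(2)[OF F] by (simp add: spike_one)
next
  fix g h assume "g \<in> carrier G" "spike i g \<in> F" "h \<in> carrier G" "g \<preceq> h"
  then show "spike i h \<in> F" using normal_filterD(3)[OF F] spike_closed spike_le by blast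
next
  fix g h assume "g \<in> carrier G" "spike i g \<in> F" "h \<in> carrier G" "spike i h \<in> F"
  then show "spike i (g \<otimes> h) \<in> F" using normal_filterD(4)[OF F] spike_mult by metis
next
  fix g a assume "g \<in> carrier G" "spike i g \<in> F" "a \<in> carrier G"
  then show "spike i (ldiv G a (g \<otimes> a)) \<in> F" "spike i (rdiv G (a \<otimes> g) a) \<in> F"
    using normal_filterD(5,6)[OF F] spike_closed
    by (metis spike_mult spike_ldiv m_closed, metis spike_mult spike_rdiv m_closed)
qed (auto intro: ldiv_closed rdiv_closed)

definition shift_unit :: "nat \<Rightarrow> ('i, 'a) kite_elem"
  where "shift_unit n = (n, \<lambda>i\<in>J n. \<one>)"

lemma shift_unit_closed: "shift_unit n \<in> carrier K"
  by (simp add: shift_unit_def kite_carrier_iff)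

text \<open>Conjugating by the constant unit of level \<open>n\<close> transports coordinates along \<open>lam ^^ n\<close>.  Since
\<open>lam ^^ n\<close> is injective on \<open>J n\<close>, a spike is sent to a spike.\<close>

lemma spike_shift_forward:
  assumes g: "g \<in> carrier G" and i: "i \<in> J n"
  shows "rdiv K (shift_unit n \<otimes>\<^bsub>K\<^esub> spike i g) (shift_unit n) = spike ((lam ^^ n) i) g"
proof -
  have sub: "J n \<subseteq> I0" using index_antimono[of 0 n] by simp
  have "(lam ^^ n) k = (lam ^^ n) i \<longleftrightarrow> k = i" if "k \<in> J n" for k
    using iter_inj[of n] that i by (auto simp: inj_on_def)
  moreover have "inv_into (J n) (lam ^^ n) ((lam ^^ n) k) = k" if "k \<in> J n" for k
    using inv_iter that by blast
  ultimately show ?thesis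
    using g i sub by (auto simp: spike_def shift_unit_def rdiv_one fun_eq_iff restrict_def image_iff)
qed

lemma spike_shift_backward:
  assumes g: "g \<in> carrier G" and i: "i \<in> J n"
  shows "ldiv K (shift_unit n) (spike ((lam ^^ n) i) g \<otimes>\<^bsub>K\<^esub> shift_unit n) = spike i g"
proof -
  have "(lam ^^ n) k \<in> I0" if "k \<in> J n" for k
    using index_add[of k 0 n] that by simp
  moreover have "(lam ^^ n) k = (lam ^^ n) i \<longleftrightarrow> k = i" if "k \<in> J n" for k
    using iter_inj[of n] that i by (auto simp: inj_on_def)
  ultimately show ?thesis
    using g i by (auto simp: spike_def shift_unit_def one_ldiv fun_eq_iff restrict_def)
qed

abbreviation chained :: "'i \<Rightarrow> 'i \<Rightarrow> bool"
  where "chained i j \<equiv> \<exists>m. piter I1 lam m i j \<or> piter I1 lam m j i"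

lemma spike_chained:
  assumes F: "normal_filter K F" and ij: "i \<in> I0" "j \<in> I0" "chained i j"
    and g: "g \<in> carrier G" and s: "spike i g \<in> F"
  shows "spike j g \<in> F"
proof -
  obtain m where "piter I1 lam m i j \<or> piter I1 lam m j i" using ij by blast
  then show ?thesis
  proof
    assume "piter I1 lam m i j"
    then have "i \<in> J m" "(lam ^^ m) i = j" using piter_iff ij by auto
    then show ?thesis
      using normal_filterD(6)[OF F s shift_unit_closed] spike_shift_forward[OF g] by metis
  next
    assume "piter I1 lam m j i"
    then have "j \<in> J m" "(lam ^^ m) j = i" using piter_iff ij by auto
    then show ?thesis
      using normal_filterD(5)[OF F s shift_unit_closed] spike_shift_backward[OF g] by metis
  qed
qed

text \<open>A non-unit of level \<open>0\<close> lies below the spike that keeps just one of its coordinates, and an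
element of a positive level lies below all of level \<open>0\<close>.\<close>

lemma nontrivial_filter_spike:
  assumes F: "normal_filter K F" "F \<noteq> {\<one>\<^bsub>K\<^esub>}"
    and G: "\<exists>a\<in>carrier G. a \<noteq> \<one>" and I0: "I0 \<noteq> {}"
  shows "\<exists>i\<in>I0. \<exists>g\<in>carrier G. g \<noteq> \<one> \<and> spike i g \<in> F"
proof -
  obtain n x where x: "(n, x) \<in> F" "(n, x) \<noteq> \<one>\<^bsub>K\<^esub>"
    using F normal_filterD(2)[OF F(1)] by fastforce
  have xK: "(n, x) \<in> carrier K" using x normal_filterD(1)[OF F(1)] by blast
  have up: "spike i g \<in> F" if "g \<in> carrier G" "n > 0 \<or> n = 0 \<and> x i = g" for i g
  proof -
    have "(n, x) \<preceq>\<^bsub>K\<^esub> spike i g"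
      using kite_le_iff[OF xK] spike_closed[OF that(1), of i] xK that
      by (auto simp: spike_def kite_carrier_iff intro!: le_refl integral dest: PiE_mem)
    then show ?thesis using normal_filterD(3)[OF F(1) x(1)] spike_closed that by blast
  qed
  show ?thesis
  proof (cases "n = 0")
    case True
    then have xG: "x \<in> I0 \<rightarrow>\<^sub>E carrier G" using xK by (simp add: kite_carrier_iff)
    have "\<exists>i\<in>I0. x i \<noteq> \<one>"
    proof (rule ccontr)
      assume "\<not> (\<exists>i\<in>I0. x i \<noteq> \<one>)"
      then have "x = (\<lambda>i\<in>I0. \<one>)" using xG by (auto simp: fun_eq_iff PiE_def extensional_def)
      then show False using x True by (simp add: kite_one_def)
    qed
    then show ?thesis using up xG True by (blast dest: PiE_mem)
  next
    case False
    then show ?thesis using up G I0 by blast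
  qed
qed

text \<open>Coordinates outside \<open>C\<close> are forced to be the unit; \<open>C\<close> may reach beyond \<open>I0\<close>, and the choice
\<open>UNIV\<close> imposes no restriction on the support.\<close>

definition supported_filter :: "'a set \<Rightarrow> 'i set \<Rightarrow> ('i, 'a) kite_elem set"
  where "supported_filter F C =
    {(0, x) |x. x \<in> I0 \<rightarrow>\<^sub>E F \<and> (\<forall>i\<in>I0 - C. x i = \<one>)}"

definition shift_closed :: "'i set \<Rightarrow> bool"
  where "shift_closed C \<longleftrightarrow> (\<forall>i\<in>I1. i \<in> C \<longleftrightarrow> lam i \<in> C)"

lemma shift_closed_iter:
  assumes "shift_closed C" "i \<in> J n"
  shows "(lam ^^ n) i \<in> C \<longleftrightarrow> i \<in> C"
  using assms(2)
proof (induction n arbitrary: i)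
  case (Suc n)
  then have "i \<in> I1" "lam i \<in> J n" by (simp_all only: index_Suc mem_Collect_eq)
  then show ?case using Suc.IH assms(1) by (auto simp: shift_closed_def funpow_Suc_right simp del: funpow.simps)
qed simp

text \<open>Nothing of positive level lies above an element of level \<open>0\<close>.  A conjugate again has level \<open>0\<close>, and each of its coordinates is either
the unit or a conjugate in \<open>G\<close> of a coordinate of the original at an index of the same orbit,
so it stays in \<open>F\<close>, and a unit coordinate is conjugated to the unit.\<close>

lemma supported_filter_normal:
  assumes F: "normal_filter G F" and C: "shift_closed C"
  shows "normal_filter K (supported_filter F C)"
proof -
  note FG = subsetD[OF normal_filterD(1)[OF F]]
  have sub: "supported_filter F C \<subseteq> carrier K"
    using FG by (fastforce simp: supported_filter_def kite_carrier_iff)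
  have J0: "i \<in> I0" if "i \<in> J n" for i n using index_antimono[of 0 n] that by auto
  have it0: "(lam ^^ n) i \<in> I0" if "i \<in> J n" for i n using index_add[of i 0 n] that by simp
  show ?thesis unfolding normal_filter_def
  proof (intro conjI ballI impI)
    show "supported_filter F C \<subseteq> carrier K" by (rule sub)
    show "\<one>\<^bsub>K\<^esub> \<in> supported_filter F C"
      using normal_filterD(2)[OF F] by (simp add: supported_filter_def kite_one_def)
  next
    fix p q assume p: "p \<in> supported_filter F C" and q: "q \<in> carrier K" "p \<preceq>\<^bsub>K\<^esub> q"
    obtain x where x: "p = (0, x)" "x \<in> I0 \<rightarrow>\<^sub>E F" "\<And>i. i \<in> I0 - C \<Longrightarrow> x i = \<one>"
      using p by (auto simp: supported_filter_def)
    obtain m y where y: "q = (m, y)" by (cases q)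
    have le: "kite_le I0 I1 lam G (0, x) (m, y)"
      using kite_le_iff[of 0 x m y] p q x(1) y sub by auto
    then have m: "m = 0" and xy: "\<And>i. i \<in> I0 \<Longrightarrow> x i \<preceq> y i" by auto
    have yG: "y \<in> I0 \<rightarrow>\<^sub>E carrier G" using q y m by (simp add: kite_carrier_iff)
    have "y i \<in> F" if "i \<in> I0" for i
      using normal_filterD(3)[OF F] x(2) yG xy that by (meson PiE_mem)
    moreover have "y i = \<one>" if "i \<in> I0 - C" for i
      using xy[of i] x(3)[of i] that yG by (metis DiffD1 PiE_mem integral le_antisym one_closed)
    ultimately show "q \<in> supported_filter F C"
      using yG y m by (auto simp: supported_filter_def PiE_def)
  next
    fix p q assume "p \<in> supported_filter F C" "q \<in> supported_filter F C"
    then obtain x y where x: "p = (0, x)" "x \<in> I0 \<rightarrow>\<^sub>E F" "\<And>i. i \<in> I0 - C \<Longrightarrow> x i = \<one>"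
      and y: "q = (0, y)" "y \<in> I0 \<rightarrow>\<^sub>E F" "\<And>i. i \<in> I0 - C \<Longrightarrow> y i = \<one>"
      by (auto simp: supported_filter_def)
    then show "p \<otimes>\<^bsub>K\<^esub> q \<in> supported_filter F C"
      by (auto simp: supported_filter_def intro!: normal_filterD(4)[OF F] dest: PiE_mem)
  next
    fix p q assume p: "p \<in> supported_filter F C" and q: "q \<in> carrier K"
    obtain x where x: "p = (0, x)" "x \<in> I0 \<rightarrow>\<^sub>E F" "\<And>i. i \<in> I0 \<Longrightarrow> i \<notin> C \<Longrightarrow> x i = \<one>"
      using p by (auto simp: supported_filter_def)
    obtain n a where a: "q = (n, a)" by (cases q)
    have aG: "a i \<in> carrier G" if "i \<in> J n" for i
      using q a that by (auto simp: kite_carrier_iff dest: PiE_mem)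
    have xF: "x i \<in> F" if "i \<in> I0" for i using x(2) that by (rule PiE_mem)
    have l: "ldiv G (a i) (x ((lam ^^ n) i) \<otimes> a i) \<in> F" if "i \<in> J n" for i
      using normal_filterD(5)[OF F xF aG] it0 that by blast
    have l1: "ldiv G (a i) (x ((lam ^^ n) i) \<otimes> a i) = \<one>" if "i \<in> J n" "i \<notin> C" for i
    proof -
      have "x ((lam ^^ n) i) = \<one>" using x(3) it0 shift_closed_iter[OF C] that by blast
      then show ?thesis using aG[OF that(1)] le_refl by (simp add: ldiv_eq_one)
    qed
    have r: "rdiv G (a i \<otimes> x i) (a i) \<in> F" if "i \<in> J n" for i
      using normal_filterD(6)[OF F xF aG] J0 that by blast
    have r1: "rdiv G (a i \<otimes> x i) (a i) = \<one>" if "i \<in> J n" "(lam ^^ n) i \<notin> C" for i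
    proof -
      have "x i = \<one>" using x(3) J0 shift_closed_iter[OF C] that by blast
      then show ?thesis using aG[OF that(1)] le_refl by (simp add: rdiv_eq_one)
    qed
    have inv: "inv_into (J n) (lam ^^ n) ((lam ^^ n) i) = i" if "i \<in> J n" for i
      using inv_iter that by blast
    show "ldiv K q (p \<otimes>\<^bsub>K\<^esub> q) \<in> supported_filter F C"
      using l l1 normal_filterD(2)[OF F] by (simp add: supported_filter_def x(1) a)
    show "rdiv K (q \<otimes>\<^bsub>K\<^esub> p) q \<in> supported_filter F C"
      using r r1 normal_filterD(2)[OF F] by (auto simp: supported_filter_def x(1) a inv)
  qed
qed

lemma supported_filter_nontrivial:
  assumes "normal_filter G F" "i \<in> I0" "i \<in> C" "g \<in> F" "g \<noteq> \<one>"
  shows "supported_filter F C \<noteq> {\<one>\<^bsub>K\<^esub>}"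
proof -
  have "spike i g \<in> supported_filter F C"
    using assms normal_filterD(2)[OF assms(1)] by (auto simp: spike_def supported_filter_def)
  then show ?thesis using spike_eq_one assms by blast
qed

lemma piter_Suc_left: "j \<in> I1 \<Longrightarrow> piter I1 lam (Suc m) j k \<longleftrightarrow> piter I1 lam m (lam j) k"
  using I1_sub lam_funcset
  by (subst (1 2) piter_iff)
    (auto simp: index_Suc funpow_Suc_right simp del: funpow.simps kite_index.simps)

text \<open>Here injectivity of \<open>lam\<close> enters: \<open>j\<close> is the only predecessor of \<open>lam j\<close>.\<close>

lemma piter_Suc_right:
  assumes "j \<in> I1" "i \<in> I0"
  shows "piter I1 lam (Suc m) i (lam j) \<longleftrightarrow> piter I1 lam m i j"
  using assms lam_inj by (auto simp: piter_def relpow_Suc_I inj_on_def elim!: relpow_Suc_E)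

lemma piter_0: "piter I1 lam 0 i j \<longleftrightarrow> i = j"
  by (simp add: piter_def)

text \<open>By injectivity the orbit of \<open>i\<close> is a single chain, so everything connected to \<open>i\<close> is an iterate
of \<open>i\<close> or has \<open>i\<close> as an iterate.\<close>

lemma shift_closed_chain:
  assumes i: "i \<in> I0"
  shows "shift_closed {j. chained i j}"
  unfolding shift_closed_def mem_Collect_eq
proof (intro ballI)
  fix j assume j: "j \<in> I1"
  note left = piter_Suc_left[OF j] and right = piter_Suc_right[OF j i]
  have step: "piter I1 lam (Suc 0) j (lam j)" using left piter_0 by blast
  show "chained i j \<longleftrightarrow> chained i (lam j)"
  proof
    assume "chained i j"
    then obtain m where "piter I1 lam m i j \<or> piter I1 lam m j i" by blast
    then show "chained i (lam j)"
    proof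
      assume "piter I1 lam m j i"
      then show ?thesis using left piter_0 step by (cases m) metis+
    qed (use right in blast)
  next
    assume "chained i (lam j)"
    then obtain m where "piter I1 lam m i (lam j) \<or> piter I1 lam m (lam j) i" by blast
    then show "chained i j"
    proof
      assume "piter I1 lam m i (lam j)"
      then show ?thesis using right piter_0 step by (cases m) metis+
    qed (use left in blast)
  qed
qed

lemma shift_closed_chained:
  assumes "shift_closed C" "i \<in> I0" "j \<in> I0" "chained i j"
  shows "i \<in> C \<longleftrightarrow> j \<in> C"
  using assms shift_closed_iter[OF assms(1)] piter_iff by metis

section \<open>Subdirectly irreducible kites\<close>

lemma subdirectly_irreducible_kite:
  assumes si: "subdirectly_irreducible G" and I0: "I0 \<noteq> {}"
    and conn: "\<And>i j. i \<in> I0 \<Longrightarrow> j \<in> I0 \<Longrightarrow> chained i j"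
  shows "subdirectly_irreducible K"
proof -
  interpret KL: integral_residuated_lattice K by (rule kite_integral_residuated_lattice)
  obtain c where c: "c \<in> carrier G" "c \<noteq> \<one>"
    and cF: "\<And>F. normal_filter G F \<Longrightarrow> F \<noteq> {\<one>} \<Longrightarrow> c \<in> F"
    using si subdirectly_irreducible_iff by blast
  obtain i0 where i0: "i0 \<in> I0" using I0 by blast
  have "spike i0 c \<in> F" if F: "normal_filter K F" "F \<noteq> {\<one>\<^bsub>K\<^esub>}" for F
  proof -
    obtain i g where ig: "i \<in> I0" "g \<in> carrier G" "g \<noteq> \<one>" "spike i g \<in> F"
      using nontrivial_filter_spike[OF F] c I0 by blast
    then have "c \<in> {g \<in> carrier G. spike i g \<in> F}"
      using cF[OF spike_filter[OF F(1), of i]] by blast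
    then show ?thesis using spike_chained[OF F(1) ig(1) i0 conn[OF ig(1) i0]] by blast
  qed
  moreover have "spike i0 c \<in> carrier K" "spike i0 c \<noteq> \<one>\<^bsub>K\<^esub>"
    using spike_closed spike_eq_one i0 c by blast+
  ultimately show ?thesis using KL.subdirectly_irreducible_iff by blast
qed

lemma kite_subdirectly_irreducibleD:
  assumes si: "subdirectly_irreducible K" and I0: "I0 \<noteq> {}" and nt: "nontrivial G"
  shows "subdirectly_irreducible G" and "i \<in> I0 \<Longrightarrow> j \<in> I0 \<Longrightarrow> chained i j"
proof -
  interpret KL: integral_residuated_lattice K by (rule kite_integral_residuated_lattice)
  obtain c where c: "c \<noteq> \<one>\<^bsub>K\<^esub>"
    and cF: "\<And>F. normal_filter K F \<Longrightarrow> F \<noteq> {\<one>\<^bsub>K\<^esub>} \<Longrightarrow> c \<in> F"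
    using si KL.subdirectly_irreducible_iff by blast
  obtain g where g: "g \<in> carrier G" "g \<noteq> \<one>" using nt by (auto simp: nontrivial_def)
  have cS: "c \<in> supported_filter F C"
    if "normal_filter G F" "shift_closed C" "k \<in> I0" "k \<in> C" "h \<in> F" "h \<noteq> \<one>" for F C k h
    using cF[OF supported_filter_normal supported_filter_nontrivial] that by blast
  \<comment> \<open>With full support the filter depends on \<open>F\<close> alone, so \<open>c\<close> has coordinates in every
    nontrivial normal filter \<open>F\<close> of \<open>G\<close>.\<close>
  have UN: "shift_closed UNIV" by (simp add: shift_closed_def)
  obtain k where k: "k \<in> I0" using I0 by blast
  obtain x where x: "c = (0, x)" "x \<in> I0 \<rightarrow>\<^sub>E carrier G"
    using cS[OF normal_filter_carrier UN k _ g] by (auto simp: supported_filter_def)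
  have "\<exists>j\<in>I0. x j \<noteq> \<one>"
  proof (rule ccontr)
    assume "\<not> (\<exists>j\<in>I0. x j \<noteq> \<one>)"
    then have "x = (\<lambda>j\<in>I0. \<one>)" using x by (auto simp: fun_eq_iff PiE_def extensional_def)
    then show False using x c by (simp add: kite_one_def)
  qed
  then obtain l where l: "l \<in> I0" "x l \<noteq> \<one>" by blast
  have "x l \<in> F" if F: "normal_filter G F" "F \<noteq> {\<one>}" for F
  proof -
    obtain h where "h \<in> F" "h \<noteq> \<one>" using F normal_filterD(2)[OF F(1)] by blast
    then have "c \<in> supported_filter F UNIV" using cS[OF F(1) UN k] by blast
    then show ?thesis using x l by (auto simp: supported_filter_def dest: PiE_mem)
  qed
  then show "subdirectly_irreducible G"
    using subdirectly_irreducible_iff l x by (meson PiE_mem)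
  \<comment> \<open>With arbitrary values the filter depends on its support alone: \<open>c\<close> is the unit at all indices
    outside the orbit of \<open>i\<close>, so the orbit contains \<open>l\<close>.\<close>
  have chain: "chained i l" if i: "i \<in> I0" for i
  proof -
    have "chained i i" using piter_0 by blast
    then have "c \<in> supported_filter (carrier G) {j. chained i j}"
      using cS[OF normal_filter_carrier shift_closed_chain[OF i] i _ g] by blast
    then show ?thesis using x l by (auto simp: supported_filter_def)
  qed
  show "chained i j" if ij: "i \<in> I0" "j \<in> I0"
    using shift_closed_chained[OF shift_closed_chain[OF ij(1)] ij(2) l(1) chain[OF ij(2)]]
      chain[OF ij(1)] by blast
qed

end

theorem theorem5p4:
  fixes G :: "'a residuated_lattice"
    and I0 I1 :: "'i set"
    and lam :: "'i \<Rightarrow> 'i"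
  assumes "integral_residuated_lattice G"
    and "nontrivial G"
    and "I1 \<subseteq> I0"
    and "I1 \<noteq> {}"
    and "lam \<in> I1 \<rightarrow> I0"
    and "inj_on lam I1"
  shows "(subdirectly_irreducible G \<and>
          (\<forall>i\<in>I0. \<forall>j\<in>I0. \<exists>m. piter I1 lam m i j \<or> piter I1 lam m j i))
         \<longleftrightarrow> subdirectly_irreducible (kite I0 I1 lam G)"
proof -
  interpret kite_data G I0 I1 lam
    using assms by (simp add: kite_data_def kite_data_axioms_def)
  have "I0 \<noteq> {}" using assms by blast
  then show ?thesis
    using subdirectly_irreducible_kite kite_subdirectly_irreducibleD assms(2) by blast
qed

end
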